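(* Assume the setup below with $d_n=1$ for all $n\in\mathbb Z$. Then there exist constants $C,\gamma\in(0,\infty)$ such that for all $m\in\mathbb Z$, $$\int_\Omega \Big(\sup_{t\in\mathbb R}\big|\langle\delta_m,e^{-itJ_\omega}\delta_0\rangle\big|\Big)\,d\mu(\omega)\le Ce^{-\gamma|m|}.$$
   Context: Setup: $r:\mathbb R\to[0,\infty)$ is bounded, measurable, compactly supported, with $\int_{\mathbb R} r(x)\,dx=1$. $(d_n)_{n\in\mathbb Z}$ is a fixed sequence of positive reals and $r_n(x)=d_n^{-1}r(d_n^{-1}x)$. $c\in\ell^\infty(\mathbb Z)$ is a real sequence (background potential). $a\in\ell^\infty(\mathbb Z)$ is real with $a(n)\ge\delta>0$ for all $n$. $\Omega=\mathbb R^{\mathbb Z}$ and $\mu$ is the product probability measure $d\mu(\omega)=\prod_{n\in\mathbb Z} r_n(\omega(n)-c(n))\,d\omega(n)$. For $\omega\in\Omega$, $J_\omega$ is the operator on $\ell^2(\mathbb Z)$ given by $(J_\omega\phi)(n)=a(n)\phi(n+1)+a(n-1)\phi(n-1)+\omega(n)\phi(n)$. $\delta_m$ denotes the standard basis vector of $\ell^2(\mathbb Z)$ at site $m$. *)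

theory Defs
  imports "HOL-Probability.Probability"
begin

text \<open>Matrix entries of the Jacobi operator J_omega on l2(Z):
  (J phi)(n) = a(n) phi(n+1) + a(n-1) phi(n-1) + omega(n) phi(n),
  so the entry in row m, column n is a(m) if n = m+1, a(m-1) if n = m-1,
  omega(m) if n = m, and 0 otherwise.\<close>
definition jac_entry :: "(int \<Rightarrow> real) \<Rightarrow> (int \<Rightarrow> real) \<Rightarrow> int \<Rightarrow> int \<Rightarrow> real" where
  "jac_entry a \<omega> m n =
     (if n = m + 1 then a m else if n = m - 1 then a (m - 1) else if n = m then \<omega> m else 0)"

text \<open>Matrix entries of the powers J_omega^k (each row of J has at most three nonzero entries).\<close>
fun jac_pow :: "(int \<Rightarrow> real) \<Rightarrow> (int \<Rightarrow> real) \<Rightarrow> nat \<Rightarrow> int \<Rightarrow> int \<Rightarrow> real" where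
  "jac_pow a \<omega> 0 m n = (if m = n then 1 else 0)"
| "jac_pow a \<omega> (Suc k) m n = (\<Sum>j\<in>{m - 1..m + 1}. jac_entry a \<omega> m j * jac_pow a \<omega> k j n)"

text \<open>The matrix element of the (bounded) unitary e^{-itJ_omega} between delta_m and delta_n,
  given by the exponential series: sum_k (-i t)^k / k! (J^k)_{m,n}.\<close>
definition evol_entry :: "(int \<Rightarrow> real) \<Rightarrow> (int \<Rightarrow> real) \<Rightarrow> real \<Rightarrow> int \<Rightarrow> int \<Rightarrow> complex" where
  "evol_entry a \<omega> t m n =
     (\<Sum>k. ((- \<i> * complex_of_real t) ^ k / of_nat (fact k)) * complex_of_real (jac_pow a \<omega> k m n))"

definition site_measure :: "(real \<Rightarrow> real) \<Rightarrow> (int \<Rightarrow> real) \<Rightarrow> (int \<Rightarrow> real) \<Rightarrow> int \<Rightarrow> real measure" where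
  "site_measure r d c n = density lborel (\<lambda>x. ennreal (r ((x - c n) / d n) / d n))"

definition anderson_measure :: "(real \<Rightarrow> real) \<Rightarrow> (int \<Rightarrow> real) \<Rightarrow> (int \<Rightarrow> real) \<Rightarrow> (int \<Rightarrow> real) measure" where
  "anderson_measure r d c = Pi\<^sub>M UNIV (site_measure r d c)"

end

theory Submission
  imports Defs "HOL-Computational_Algebra.Fundamental_Theorem_Algebra"
begin

text \<open>
  The proof is the Kunz--Souillard method. In a finite box the matrix element is bounded, uniformly in time, by
  the sum of \<open>\<bar>\<phi> m * \<phi> 0\<bar>\<close> over the normalized eigenvectors. Averaging over the potential at one of the two
  sites replaces the sum over eigenvalues by an integral over the energy \<open>E\<close> in a bounded interval and the
  product by the ratio \<open>\<bar>\<phi> q / \<phi> p\<bar>\<close> of a solution. For fixed \<open>E\<close>, the ratios of consecutive values form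
  a Markov chain, and integrating out the potentials between the two sites applies to a density the operators
  \<open>K U\<close>, where \<open>K\<close> is convolution with \<open>r\<close> (up to reflection and translation) and \<open>U g z = b / \<bar>z\<bar> * g (b\<^sup>2 / z)\<close>
  is an \<open>L\<^sup>2\<close> isometry.

  The norm of \<open>K U K\<close> is less than 1, uniformly in the parameters: if \<open>K\<close> loses little mass of \<open>g\<close>, then \<open>g\<close> is nearly
  invariant under some shift bounded away from zero, so a fixed interval \<open>{-A..A}\<close> carries little of its mass.
  This cannot hold both for a function and for its image under \<open>U\<close>, which exchanges the interval with its
  complement. Fatou's lemma transfers the resulting bound from boxes to the full lattice.
\<close>

section \<open>Almost shift-invariant functions\<close>

text \<open>Spectral averaging leaves the first power of the ratio
  \<open>\<bar>\<phi> q / \<phi> p\<bar>\<close>, and this selects \<open>L\<^sup>2\<close>: the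
  weight \<open>b / \<bar>z\<bar>\<close> is the square root of the Jacobian
  \<open>b\<^sup>2 / z\<^sup>2\<close> of the map \<open>b\<^sup>2 / z\<close>. With the second
  power the same operators would preserve \<open>L\<^sup>1\<close> mass, and no decay could result.
  The obstacle is that K alone has norm 1, since it loses arbitrarily little of a widely spread
  function. As U is an isometry onto \<open>L\<^sup>2\<close>, the product K U has norm 1 as well. A
  gain appears only with a convolution on each side of U. Energy and background enter only as the
  translation \<open>e\<close> of K, and the hopping only as a radius \<open>b \<le> A\<close>, so
  the contraction factor depends on the density and on \<open>A\<close> alone. All functions take
  values in \<open>ennreal\<close>, which frees the argument from integrability conditions; in
  return, losses are never written as differences, and identities and estimates are put in additive
  form. Potentials and densities are chosen bounded so that all box eigenvalues lie in one fixed
  energy window, independent of the box.\<close>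

definition sqdist :: "ennreal \<Rightarrow> ennreal \<Rightarrow> ennreal" where
  "sqdist u v = (u - v)\<^sup>2 + (v - u)\<^sup>2"

text \<open>Subtraction in \<open>ennreal\<close> truncates at zero, so one of the two summands of
  \<open>sqdist\<close> vanishes and the other is the usual square. With an infinite argument the
  value is \<open>top\<close>, which lets the inequalities below hold without finiteness
  assumptions.\<close>

lemma sqdist_ennreal:
  assumes "0 \<le> x" "0 \<le> y"
  shows "sqdist (ennreal x) (ennreal y) = ennreal ((x - y)\<^sup>2)"
proof (cases "x \<le> y")
  case True
  then show ?thesis using assms
    by (auto simp: sqdist_def ennreal_minus ennreal_power power2_commute ennreal_neg)
next
  case False
  then show ?thesis using assms
    by (auto simp: sqdist_def ennreal_minus ennreal_power ennreal_neg)
qed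

lemma sqdist_top [simp]: "sqdist top v = top" "sqdist u top = top"
  by (auto simp: sqdist_def)

lemma sqdist_measurable [measurable]:
  assumes [measurable]: "f \<in> borel_measurable M" "g \<in> borel_measurable M"
  shows "(\<lambda>x. sqdist (f x) (g x)) \<in> borel_measurable M"
  unfolding sqdist_def by measurable

text \<open>The expansion of a squared difference with the mixed term moved to the left, so that it
  holds for infinite values too. Integrated over two independent samples it becomes the variance
  identity in \<open>conv_energy\<close>.\<close>

lemma sqdist_polarization: "2 * (u * v) + sqdist u v = u\<^sup>2 + v\<^sup>2"
proof (cases u; cases v)
  fix x y :: real assume h: "0 \<le> x" "u = ennreal x" "0 \<le> y" "v = ennreal y"
  have "2 * (u * v) + sqdist u v = ennreal (2 * (x * y) + (x - y)\<^sup>2)"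
    using h by (simp add: sqdist_ennreal ennreal_mult flip: ennreal_numeral)
  also have "2 * (x * y) + (x - y)\<^sup>2 = x\<^sup>2 + y\<^sup>2" by (simp add: power2_eq_square algebra_simps)
  finally show ?thesis using h by (simp add: ennreal_power)
qed auto

lemma sq_le_sqdist: "u\<^sup>2 \<le> 2 * v\<^sup>2 + 2 * sqdist u v"
proof (cases u; cases v)
  fix x y :: real assume h: "0 \<le> x" "u = ennreal x" "0 \<le> y" "v = ennreal y"
  have "x\<^sup>2 \<le> 2 * y\<^sup>2 + 2 * (x - y)\<^sup>2"
    using zero_le_power2[of "x - 2 * y"] by (simp add: power2_eq_square algebra_simps)
  then have "ennreal (x\<^sup>2) \<le> ennreal (2 * y\<^sup>2 + 2 * (x - y)\<^sup>2)" by (rule ennreal_leI)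
  then show ?thesis using h
    by (simp add: sqdist_ennreal ennreal_power ennreal_mult flip: ennreal_numeral)
qed auto

lemma sqdist_triangle: "sqdist u w \<le> 2 * sqdist u v + 2 * sqdist v w"
proof (cases u; cases v; cases w)
  fix x y z :: real
  assume h: "0 \<le> x" "u = ennreal x" "0 \<le> y" "v = ennreal y" "0 \<le> z" "w = ennreal z"
  have "(x - z)\<^sup>2 \<le> 2 * (x - y)\<^sup>2 + 2 * (y - z)\<^sup>2"
    using zero_le_power2[of "x + z - 2 * y"] by (simp add: power2_eq_square algebra_simps)
  then have "ennreal ((x - z)\<^sup>2) \<le> ennreal (2 * (x - y)\<^sup>2 + 2 * (y - z)\<^sup>2)" by (rule ennreal_leI)
  then show ?thesis using h
    by (simp add: sqdist_ennreal ennreal_mult flip: ennreal_numeral)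
qed auto

lemma nn_integral_lborel_shift:
  fixes f :: "real \<Rightarrow> ennreal"
  assumes [measurable]: "f \<in> borel_measurable borel"
  shows "(\<integral>\<^sup>+x. f (x + t) \<partial>lborel) = (\<integral>\<^sup>+x. f x \<partial>lborel)"
  using nn_integral_real_affine[of f 1 t] by (simp add: add.commute)

lemma nn_integral_lborel_reflect:
  fixes f :: "real \<Rightarrow> ennreal"
  assumes [measurable]: "f \<in> borel_measurable borel"
  shows "(\<integral>\<^sup>+x. f (t - x) \<partial>lborel) = (\<integral>\<^sup>+x. f x \<partial>lborel)"
  using nn_integral_real_affine[of f "-1" t] by simp

definition sqnorm :: "(real \<Rightarrow> ennreal) \<Rightarrow> ennreal" where
  "sqnorm g = (\<integral>\<^sup>+x. (g x)\<^sup>2 \<partial>lborel)"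

definition sqmass :: "real set \<Rightarrow> (real \<Rightarrow> ennreal) \<Rightarrow> ennreal" where
  "sqmass S g = (\<integral>\<^sup>+x. (g x)\<^sup>2 * indicator S x \<partial>lborel)"

definition shift_energy :: "(real \<Rightarrow> ennreal) \<Rightarrow> real \<Rightarrow> ennreal" where
  "shift_energy g t = (\<integral>\<^sup>+x. sqdist (g x) (g (x + t)) \<partial>lborel)"

text \<open>Each further shift by \<open>t\<close> uses the squared triangle inequality, which
  doubles both terms; this gives the factor 4 per step. Growth in \<open>k\<close> is harmless
  because \<open>k\<close> is later fixed.\<close>

lemma shift_energy_mult:
  assumes [measurable]: "g \<in> borel_measurable borel"
  shows "shift_energy g (real k * t) \<le> 4 ^ k * shift_energy g t"
proof (induction k)
  case 0
  have "sqdist (g x) (g x) \<le> 4 ^ 0 * sqdist (g x) (g (x + t))" for x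
    by (cases "g x") (auto simp: sqdist_ennreal)
  then show ?case
    by (auto simp: shift_energy_def intro!: nn_integral_mono)
next
  case (Suc k)
  have "shift_energy g (real (Suc k) * t)
      \<le> (\<integral>\<^sup>+x. 2 * sqdist (g x) (g (x + k * t)) + 2 * sqdist (g (x + k * t)) (g (x + k * t + t)) \<partial>lborel)"
    unfolding shift_energy_def
  proof (intro nn_integral_mono)
    fix x
    show "sqdist (g x) (g (x + real (Suc k) * t))
        \<le> 2 * sqdist (g x) (g (x + k * t)) + 2 * sqdist (g (x + k * t)) (g (x + k * t + t))"
      using sqdist_triangle[of "g x" "g (x + k * t + t)" "g (x + k * t)"]
      by (simp add: algebra_simps)
  qed
  also have "\<dots> = 2 * shift_energy g (k * t)
      + 2 * (\<integral>\<^sup>+x. sqdist (g (x + k * t)) (g (x + k * t + t)) \<partial>lborel)"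
    unfolding shift_energy_def by (simp add: nn_integral_add nn_integral_cmult)
  also have "(\<integral>\<^sup>+x. sqdist (g (x + k * t)) (g (x + k * t + t)) \<partial>lborel) = shift_energy g t"
    unfolding shift_energy_def
    by (rule nn_integral_lborel_shift[of "\<lambda>x. sqdist (g x) (g (x + t))"]) measurable
  also have "2 * shift_energy g (k * t) + 2 * shift_energy g t
      \<le> 2 * (4 ^ k * shift_energy g t) + 2 * (4 ^ k * shift_energy g t)"
    using mult_right_mono[of 1 "4 ^ k" "shift_energy g t"]
    by (intro add_mono mult_left_mono Suc.IH) auto
  also have "\<dots> = 4 ^ Suc k * shift_energy g t"
    by (simp add: algebra_simps flip: distrib_right)
  finally show ?case .
qed

lemma sqmass_shift:
  assumes [measurable]: "g \<in> borel_measurable borel" "S \<in> sets borel"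
  shows "sqmass S g \<le> 2 * sqmass ((\<lambda>x. x + t) ` S) g + 2 * shift_energy g t"
proof -
  have ind: "indicator ((\<lambda>x. x + t) ` S) (x + t) = (indicator S x :: ennreal)" for x
    by (auto simp: indicator_def)
  have eq: "(\<lambda>x. x + t) ` S = (\<lambda>x. x - t) -` S" by (auto simp: image_iff) (metis diff_add_cancel)
  have [measurable]: "(\<lambda>x. x + t) ` S \<in> sets borel"
    unfolding eq by (rule measurable_sets_borel[of _ borel]) auto
  have "sqmass S g \<le> (\<integral>\<^sup>+x. 2 * ((g (x + t))\<^sup>2 * indicator S x) + 2 * sqdist (g x) (g (x + t)) \<partial>lborel)"
    unfolding sqmass_def
  proof (intro nn_integral_mono)
    fix x
    show "(g x)\<^sup>2 * indicator S x \<le> 2 * ((g (x + t))\<^sup>2 * indicator S x) + 2 * sqdist (g x) (g (x + t))"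
      using sq_le_sqdist[of "g x" "g (x + t)"] by (auto simp: indicator_def)
  qed
  also have "\<dots> = 2 * (\<integral>\<^sup>+x. (g (x + t))\<^sup>2 * indicator S x \<partial>lborel) + 2 * shift_energy g t"
    by (simp add: nn_integral_add nn_integral_cmult shift_energy_def)
  also have "(\<integral>\<^sup>+x. (g (x + t))\<^sup>2 * indicator S x \<partial>lborel) = sqmass ((\<lambda>x. x + t) ` S) g"
    unfolding sqmass_def ind[symmetric]
    by (rule nn_integral_lborel_shift[of "\<lambda>x. (g x)\<^sup>2 * indicator ((\<lambda>x. x + t) ` S) x"]) measurable
  finally show ?thesis .
qed

text \<open>If \<open>g\<close> is almost invariant under a shift by \<open>\<tau>\<close>, its mass on an interval is almost
  repeated on many disjoint translates, so it is a small part of the total mass.\<close>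

lemma sqmass_interval_le:
  assumes [measurable]: "g \<in> borel_measurable borel"
    and k: "real k * \<bar>\<tau>\<bar> > 2 * M"
  shows "sqmass {c - M..c + M} g \<le> ennreal (1/8) * sqnorm g + 2 * 4 ^ (16 * k) * shift_energy g \<tau>"
proof -
  \<comment> \<open>The translates move by multiples of \<open>k * \<tau>\<close>, more than the
    length \<open>2 * M\<close>, and are therefore disjoint. Passing to a translate costs a factor 2
    by \<open>sqmass_shift\<close>, and averaging over 16 of them gives 2/16 = 1/8.\<close>
  define I where "I = (\<lambda>j. (\<lambda>x. x + real (j * k) * \<tau>) ` {c - M..c + M})"
  have I_eq: "I j = {c - M + real (j * k) * \<tau>..c + M + real (j * k) * \<tau>}" for j
    unfolding I_def by (simp add: image_add_atLeastAtMost' add.commute)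
  have disj: "disjoint_family_on I {1..16}"
    unfolding disjoint_family_on_def
  proof (intro ballI impI)
    fix i j :: nat assume "i \<noteq> j"
    have "2 * M < \<bar>(real i - real j) * (real k * \<tau>)\<bar>"
    proof -
      have "1 \<le> \<bar>real i - real j\<bar>" using \<open>i \<noteq> j\<close> by linarith
      then have "real k * \<bar>\<tau>\<bar> \<le> \<bar>real i - real j\<bar> * (real k * \<bar>\<tau>\<bar>)"
        using mult_right_mono[of 1 "\<bar>real i - real j\<bar>" "real k * \<bar>\<tau>\<bar>"] by simp
      then show ?thesis using k by (simp add: abs_mult)
    qed
    then show "I i \<inter> I j = {}"
      unfolding I_eq by (auto simp: algebra_simps abs_if split: if_splits)
  qed
  have one: "sqmass {c - M..c + M} g \<le> 2 * sqmass (I j) g + 2 * 4 ^ (16 * k) * shift_energy g \<tau>"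
    if "j \<in> {1..16}" for j
  proof -
    have "shift_energy g (real (j * k) * \<tau>) \<le> 4 ^ (j * k) * shift_energy g \<tau>"
      by (rule shift_energy_mult) measurable
    also have "\<dots> \<le> 4 ^ (16 * k) * shift_energy g \<tau>"
      using that by (intro mult_right_mono power_increasing) auto
    finally have "2 * shift_energy g (real (j * k) * \<tau>) \<le> 2 * 4 ^ (16 * k) * shift_energy g \<tau>"
      by (simp add: mult.assoc mult_left_mono)
    then show ?thesis
      using sqmass_shift[of g "{c - M..c + M}" "real (j * k) * \<tau>"] unfolding I_def
      by (auto intro: order_trans add_left_mono)
  qed
  have "(\<Sum>j\<in>{1..16}. sqmass (I j) g) = (\<integral>\<^sup>+x. (\<Sum>j\<in>{1..16}. (g x)\<^sup>2 * indicator (I j) x) \<partial>lborel)"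
    unfolding sqmass_def by (rule nn_integral_sum[symmetric]) (auto simp: I_eq)
  also have "\<dots> \<le> sqnorm g"
    unfolding sqnorm_def
  proof (intro nn_integral_mono)
    fix x
    have "(\<Sum>j\<in>{1..16}. (g x)\<^sup>2 * indicator (I j) x) = (g x)\<^sup>2 * (\<Sum>j\<in>{1..16}. indicator (I j) x)"
      by (simp add: sum_distrib_left)
    also have "(\<Sum>j\<in>{1..16}. indicator (I j) x) = (indicator (\<Union>j\<in>{1..16}. I j) x :: ennreal)"
      using disj by (simp add: indicator_UN_disjoint)
    also have "(g x)\<^sup>2 * \<dots> \<le> (g x)\<^sup>2 * 1"
      by (intro mult_left_mono) (auto simp: indicator_def)
    finally show "(\<Sum>j\<in>{1..16}. (g x)\<^sup>2 * indicator (I j) x) \<le> (g x)\<^sup>2" by simp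
  qed
  finally have total: "(\<Sum>j\<in>{1..16}. sqmass (I j) g) \<le> sqnorm g" .
  have "16 * sqmass {c - M..c + M} g = (\<Sum>j\<in>{1..16::nat}. sqmass {c - M..c + M} g)" by simp
  also have "\<dots> \<le> (\<Sum>j\<in>{1..16}. 2 * sqmass (I j) g + 2 * 4 ^ (16 * k) * shift_energy g \<tau>)"
    by (intro sum_mono one)
  also have "\<dots> = 2 * (\<Sum>j\<in>{1..16}. sqmass (I j) g) + 16 * (2 * 4 ^ (16 * k) * shift_energy g \<tau>)"
    by (simp add: sum.distrib sum_distrib_left)
  also have "\<dots> \<le> 2 * sqnorm g + 16 * (2 * 4 ^ (16 * k) * shift_energy g \<tau>)"
    by (intro add_mono mult_left_mono total) auto
  also have "2 * sqnorm g = 16 * (ennreal (1/8) * sqnorm g)"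
  proof -
    have "(16::ennreal) * ennreal (1/8) = ennreal (16 * (1/8))"
      by (subst ennreal_mult) (auto simp flip: ennreal_numeral)
    then show ?thesis by (simp flip: mult.assoc)
  qed
  finally have "16 * sqmass {c - M..c + M} g
      \<le> 16 * (ennreal (1/8) * sqnorm g + 2 * 4 ^ (16 * k) * shift_energy g \<tau>)"
    by (simp add: distrib_left)
  then show ?thesis
    by (subst (asm) ennreal_mult_le_mult_iff) auto
qed

section \<open>Convolution with a bounded density\<close>

locale bounded_density =
  fixes \<rho> :: "real \<Rightarrow> ennreal" and B :: real
  assumes density_measurable [measurable]: "\<rho> \<in> borel_measurable borel"
    and density_total: "(\<integral>\<^sup>+x. \<rho> x \<partial>lborel) = 1"
    and density_le: "\<rho> x \<le> ennreal B"
    and B_pos: "0 < B"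
begin

definition law :: "real measure" where "law = density lborel \<rho>"

lemma sets_law [simp, measurable_cong]: "sets law = sets borel"
  by (simp add: law_def)

lemma space_law [simp]: "space law = UNIV"
  by (simp add: law_def)

lemma prob_space_law: "prob_space law"
  by (rule prob_spaceI) (simp add: law_def emeasure_density density_total)

sublocale law: prob_space law by (rule prob_space_law)

lemma nn_integral_law:
  "f \<in> borel_measurable borel \<Longrightarrow> (\<integral>\<^sup>+x. f x \<partial>law) = (\<integral>\<^sup>+x. \<rho> x * f x \<partial>lborel)"
  unfolding law_def by (rule nn_integral_density) auto

lemma emeasure_law_UNIV [simp]: "emeasure law UNIV = 1"
  using law.emeasure_space_1 by simp

text \<open>Reflection and translation are built in because solving \<open>y = x - V - z\<close> for
  the potential gives \<open>V = x - y - z\<close>; the parameter \<open>e\<close> is the energy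
  \<open>x\<close> minus the background at the site.\<close>

definition conv :: "real \<Rightarrow> (real \<Rightarrow> ennreal) \<Rightarrow> real \<Rightarrow> ennreal" where
  "conv e g y = (\<integral>\<^sup>+z. \<rho> (e - y - z) * g z \<partial>lborel)"

lemma conv_eq_law:
  assumes [measurable]: "g \<in> borel_measurable borel"
  shows "conv e g y = (\<integral>\<^sup>+s. g (e - y - s) \<partial>law)"
  unfolding conv_def
  by (subst nn_integral_law)
    (auto simp: nn_integral_lborel_reflect[of "\<lambda>s. \<rho> s * g (e - y - s)" "e - y", symmetric])

lemma conv_measurable [measurable]:
  assumes [measurable]: "g \<in> borel_measurable borel"
  shows "conv e g \<in> borel_measurable borel"
  unfolding conv_def by measurable

lemma conv_sq_le_law:
  assumes [measurable]: "g \<in> borel_measurable borel"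
  shows "(conv e g y)\<^sup>2 \<le> (\<integral>\<^sup>+s. (g (e - y - s))\<^sup>2 \<partial>law)"
  using Cauchy_Schwarz_nn_integral[of "\<lambda>s. g (e - y - s)" law "\<lambda>_. 1"]
  by (simp add: conv_eq_law)

text \<open>\<open>conv e g\<close> averages the reflected translates \<open>g (e - y - s)\<close>
  over \<open>s\<close>. Cauchy-Schwarz against the constant 1 moves the square inside the average,
  and each translate brings its mass from a preimage of \<open>S\<close>.\<close>

lemma sqmass_conv_le:
  assumes [measurable]: "g \<in> borel_measurable borel" "S \<in> sets borel"
  shows "sqmass S (conv e g) \<le> (\<integral>\<^sup>+s. sqmass ((\<lambda>x. e - s - x) -` S) g \<partial>law)"
proof -
  interpret pair_sigma_finite lborel law ..
  have "sqmass S (conv e g) \<le> (\<integral>\<^sup>+y. (\<integral>\<^sup>+s. (g (e - y - s))\<^sup>2 \<partial>law) * indicator S y \<partial>lborel)"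
    unfolding sqmass_def by (intro nn_integral_mono mult_right_mono conv_sq_le_law) auto
  also have "\<dots> = (\<integral>\<^sup>+y. \<integral>\<^sup>+s. (g (e - y - s))\<^sup>2 * indicator S y \<partial>law \<partial>lborel)"
    by (simp add: nn_integral_multc)
  also have "\<dots> = (\<integral>\<^sup>+s. \<integral>\<^sup>+y. (g (e - y - s))\<^sup>2 * indicator S y \<partial>lborel \<partial>law)"
    by (rule Fubini'[symmetric]) measurable
  also have "\<dots> = (\<integral>\<^sup>+s. sqmass ((\<lambda>x. e - s - x) -` S) g \<partial>law)"
  proof (intro nn_integral_cong)
    fix s
    have [measurable]: "(\<lambda>x. e - s - x) -` S \<in> sets borel"
      by (rule measurable_sets_borel[of _ borel]) auto
    have "(\<integral>\<^sup>+y. (g (e - y - s))\<^sup>2 * indicator S y \<partial>lborel)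
       = (\<integral>\<^sup>+y. (\<lambda>x. (g x)\<^sup>2 * indicator ((\<lambda>x. e - s - x) -` S) x) (e - s - y) \<partial>lborel)"
      by (intro nn_integral_cong) (auto simp: indicator_def algebra_simps)
    also have "\<dots> = sqmass ((\<lambda>x. e - s - x) -` S) g"
      unfolding sqmass_def by (rule nn_integral_lborel_reflect) measurable
    finally show "(\<integral>\<^sup>+y. (g (e - y - s))\<^sup>2 * indicator S y \<partial>lborel) = sqmass ((\<lambda>x. e - s - x) -` S) g" .
  qed
  finally show ?thesis .
qed

lemma sqmass_UNIV: "sqmass UNIV g = sqnorm g"
  by (simp add: sqmass_def sqnorm_def)

lemma sqnorm_conv_le:
  assumes [measurable]: "g \<in> borel_measurable borel"
  shows "sqnorm (conv e g) \<le> sqnorm g"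
  using sqmass_conv_le[of g UNIV e] by (simp add: sqmass_UNIV)

text \<open>A bounded density maps \<open>L\<^sup>2\<close> into bounded functions. This turns decay
  in norm into the pointwise decay of \<open>transfer_decay\<close>.\<close>

lemma conv_sq_le:
  assumes [measurable]: "g \<in> borel_measurable borel"
  shows "(conv e g y)\<^sup>2 \<le> ennreal B * sqnorm g"
proof -
  have "(conv e g y)\<^sup>2 \<le> (\<integral>\<^sup>+s. \<rho> s * (g (e - y - s))\<^sup>2 \<partial>lborel)"
    using conv_sq_le_law[of g e y] by (simp add: nn_integral_law)
  also have "\<dots> \<le> (\<integral>\<^sup>+s. ennreal B * (g (e - y - s))\<^sup>2 \<partial>lborel)"
    by (intro nn_integral_mono mult_right_mono density_le) auto
  also have "\<dots> = ennreal B * (\<integral>\<^sup>+s. (g (e - y - s))\<^sup>2 \<partial>lborel)"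
    by (rule nn_integral_cmult) measurable
  also have "(\<integral>\<^sup>+s. (g (e - y - s))\<^sup>2 \<partial>lborel) = sqnorm g"
    unfolding sqnorm_def by (rule nn_integral_lborel_reflect) measurable
  finally show ?thesis .
qed

text \<open>For fixed \<open>y\<close> this is the variance identity
  \<open>2 (E X)\<^sup>2 + E (X - X')\<^sup>2 = 2 E X\<^sup>2\<close> for independent copies of
  \<open>g (e - y - s)\<close>. Integrating over \<open>y\<close> shows that the squared norm lost
  under convolution is half the mean shift energy.\<close>

lemma conv_energy:
  assumes [measurable]: "g \<in> borel_measurable borel"
  shows "2 * sqnorm (conv e g) + (\<integral>\<^sup>+s. \<integral>\<^sup>+s'. shift_energy g (s - s') \<partial>law \<partial>law) = 2 * sqnorm g"
proof -
  interpret P: pair_sigma_finite lborel law ..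
  have pt: "2 * (conv e g y)\<^sup>2 + (\<integral>\<^sup>+s. \<integral>\<^sup>+s'. sqdist (g (e - y - s)) (g (e - y - s')) \<partial>law \<partial>law)
      = 2 * (\<integral>\<^sup>+s. (g (e - y - s))\<^sup>2 \<partial>law)" for y
  proof -
    have "2 * (conv e g y)\<^sup>2 = (\<integral>\<^sup>+s. \<integral>\<^sup>+s'. 2 * (g (e - y - s) * g (e - y - s')) \<partial>law \<partial>law)"
      by (simp add: conv_eq_law power2_eq_square nn_integral_cmult nn_integral_multc mult.assoc)
    then have "2 * (conv e g y)\<^sup>2 + (\<integral>\<^sup>+s. \<integral>\<^sup>+s'. sqdist (g (e - y - s)) (g (e - y - s')) \<partial>law \<partial>law)
       = (\<integral>\<^sup>+s. \<integral>\<^sup>+s'. 2 * (g (e - y - s) * g (e - y - s'))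
            + sqdist (g (e - y - s)) (g (e - y - s')) \<partial>law \<partial>law)"
      by (simp add: nn_integral_add)
    also have "\<dots> = (\<integral>\<^sup>+s. \<integral>\<^sup>+s'. (g (e - y - s))\<^sup>2 + (g (e - y - s'))\<^sup>2 \<partial>law \<partial>law)"
      by (simp add: sqdist_polarization)
    also have "\<dots> = 2 * (\<integral>\<^sup>+s. (g (e - y - s))\<^sup>2 \<partial>law)"
      by (simp add: nn_integral_add mult_2)
    finally show ?thesis .
  qed
  have swap1: "(\<integral>\<^sup>+y. \<integral>\<^sup>+s. (g (e - y - s))\<^sup>2 \<partial>law \<partial>lborel) = sqnorm g"
  proof -
    have "(\<integral>\<^sup>+y. \<integral>\<^sup>+s. (g (e - y - s))\<^sup>2 \<partial>law \<partial>lborel) = (\<integral>\<^sup>+s. \<integral>\<^sup>+y. (g (e - y - s))\<^sup>2 \<partial>lborel \<partial>law)"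
      by (rule P.Fubini'[symmetric]) measurable
    also have "\<dots> = (\<integral>\<^sup>+s. sqnorm g \<partial>law)"
    proof (intro nn_integral_cong)
      fix s
      show "(\<integral>\<^sup>+y. (g (e - y - s))\<^sup>2 \<partial>lborel) = sqnorm g"
        using nn_integral_lborel_reflect[of "\<lambda>x. (g x)\<^sup>2" "e - s"]
        by (simp add: sqnorm_def algebra_simps)
    qed
    finally show ?thesis by simp
  qed
  have swap2: "(\<integral>\<^sup>+y. \<integral>\<^sup>+s. \<integral>\<^sup>+s'. sqdist (g (e - y - s)) (g (e - y - s')) \<partial>law \<partial>law \<partial>lborel)
      = (\<integral>\<^sup>+s. \<integral>\<^sup>+s'. shift_energy g (s - s') \<partial>law \<partial>law)"
  proof -
    have "(\<integral>\<^sup>+y. \<integral>\<^sup>+s. \<integral>\<^sup>+s'. sqdist (g (e - y - s)) (g (e - y - s')) \<partial>law \<partial>law \<partial>lborel)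
       = (\<integral>\<^sup>+s. \<integral>\<^sup>+y. \<integral>\<^sup>+s'. sqdist (g (e - y - s)) (g (e - y - s')) \<partial>law \<partial>lborel \<partial>law)"
      by (rule P.Fubini'[symmetric]) measurable
    also have "\<dots> = (\<integral>\<^sup>+s. \<integral>\<^sup>+s'. \<integral>\<^sup>+y. sqdist (g (e - y - s)) (g (e - y - s')) \<partial>lborel \<partial>law \<partial>law)"
      by (intro nn_integral_cong P.Fubini'[symmetric]) measurable
    also have "\<dots> = (\<integral>\<^sup>+s. \<integral>\<^sup>+s'. shift_energy g (s - s') \<partial>law \<partial>law)"
    proof (intro nn_integral_cong)
      fix s s'
      show "(\<integral>\<^sup>+y. sqdist (g (e - y - s)) (g (e - y - s')) \<partial>lborel) = shift_energy g (s - s')"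
        using nn_integral_lborel_reflect[of "\<lambda>x. sqdist (g x) (g (x + (s - s')))" "e - s"]
        by (simp add: shift_energy_def algebra_simps)
    qed
    finally show ?thesis .
  qed
  have "2 * sqnorm (conv e g) + (\<integral>\<^sup>+s. \<integral>\<^sup>+s'. shift_energy g (s - s') \<partial>law \<partial>law)
      = (\<integral>\<^sup>+y. 2 * (conv e g y)\<^sup>2 + (\<integral>\<^sup>+s. \<integral>\<^sup>+s'. sqdist (g (e - y - s)) (g (e - y - s')) \<partial>law \<partial>law) \<partial>lborel)"
    unfolding swap2[symmetric] sqnorm_def
    by (subst nn_integral_add) (auto simp: nn_integral_cmult)
  also have "\<dots> = 2 * sqnorm g"
    by (simp add: pt nn_integral_cmult swap1)
  finally show ?thesis .
qed

text \<open>An interval of length \<open>1 / (2 * B)\<close> has probability at most 1/2 under a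
  density bounded by \<open>B\<close>. Hence two independent samples differ by a definite amount
  with probability at least 1/2.\<close>

lemma law_far: "ennreal (1/2) \<le> (\<integral>\<^sup>+s'. indicator {s'. 1 / (4 * B) \<le> \<bar>s - s'\<bar>} s' \<partial>law)"
proof -
  have "(\<integral>\<^sup>+s'. indicator {s - 1 / (4 * B)..s + 1 / (4 * B)} s' \<partial>law)
     \<le> (\<integral>\<^sup>+s'. ennreal B * indicator {s - 1 / (4 * B)..s + 1 / (4 * B)} s' \<partial>lborel)"
    by (subst nn_integral_law) (auto intro!: nn_integral_mono mult_right_mono density_le)
  also have "\<dots> = ennreal B * ennreal (1 / (2 * B))"
    using B_pos by (simp add: nn_integral_cmult divide_simps)
  also have "\<dots> = ennreal (1/2)"
    using B_pos by (simp flip: ennreal_mult)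
  finally have near: "(\<integral>\<^sup>+s'. indicator {s - 1 / (4 * B)..s + 1 / (4 * B)} s' \<partial>law) \<le> ennreal (1/2)" .
  have m[measurable]: "{s'. 1 / (4 * B) \<le> \<bar>s - s'\<bar>} \<in> sets borel" by measurable
  have "1 = (\<integral>\<^sup>+s'. 1 \<partial>law)" by simp
  also have "\<dots> \<le> (\<integral>\<^sup>+s'. indicator {s - 1 / (4 * B)..s + 1 / (4 * B)} s'
      + indicator {s'. 1 / (4 * B) \<le> \<bar>s - s'\<bar>} s' \<partial>law)"
    by (intro nn_integral_mono) (auto simp: indicator_def)
  also have "\<dots> = (\<integral>\<^sup>+s'. indicator {s - 1 / (4 * B)..s + 1 / (4 * B)} s' \<partial>law)
      + (\<integral>\<^sup>+s'. indicator {s'. 1 / (4 * B) \<le> \<bar>s - s'\<bar>} s' \<partial>law)"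
    by (rule nn_integral_add) auto
  also have "\<dots> \<le> ennreal (1/2) + (\<integral>\<^sup>+s'. indicator {s'. 1 / (4 * B) \<le> \<bar>s - s'\<bar>} s' \<partial>law)"
    by (intro add_mono near order_refl)
  finally have le: "1 \<le> ennreal (1/2) + (\<integral>\<^sup>+s'. indicator {s'. 1 / (4 * B) \<le> \<bar>s - s'\<bar>} s' \<partial>law)" .
  have "ennreal (1/2) + ennreal (1/2) = ennreal (1/2 + 1/2)"
    by (rule ennreal_plus[symmetric]) auto
  then have "ennreal (1/2) + ennreal (1/2) = 1" by simp
  then have "ennreal (1/2) + ennreal (1/2) \<le> ennreal (1/2) + (\<integral>\<^sup>+s'. indicator {s'. 1 / (4 * B) \<le> \<bar>s - s'\<bar>} s' \<partial>law)"
    using le by simp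
  then show ?thesis
    by (subst (asm) ennreal_add_left_cancel_le) auto
qed

text \<open>A function whose mass is not lost under convolution cannot be concentrated on an interval.\<close>

lemma sqmass_add_sqnorm_conv_le:
  fixes M :: real
  obtains K :: real where "K > 0"
    "\<And>g e c. g \<in> borel_measurable borel \<Longrightarrow>
      sqmass {c - M..c + M} g + ennreal K * sqnorm (conv e g) \<le> ennreal (1 / 4 + K) * sqnorm g"
proof -
  \<comment> \<open>With this \<open>k\<close>, every difference \<open>s - s'\<close> of size at
    least \<open>1 / (4 * B)\<close> is an admissible shift in
    \<open>sqmass_interval_le\<close>.\<close>
  obtain k :: nat where k: "real k * (1 / (4 * B)) > 2 * M"
    using ex_less_of_nat_mult[of "1 / (4 * B)" "2 * M"] B_pos by auto
  define C :: real where "C = 2 * 4 ^ (16 * k)"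
  have C_ennreal: "ennreal C = 2 * 4 ^ (16 * k)"
    by (simp add: C_def ennreal_mult flip: ennreal_power ennreal_numeral)
  have "C > 0" by (simp add: C_def)
  show thesis
  \<comment> \<open>Far pairs have probability at least 1/2, so the interval estimate is doubled:
    1/8 becomes 1/4 and \<open>C\<close> becomes \<open>2 * C\<close>. The shift energy is twice the
    loss of squared norm, which gives \<open>4 * C\<close>.\<close>
  proof (rule that[of "4 * C"])
    show "0 < 4 * C" using \<open>C > 0\<close> by simp
    fix g :: "real \<Rightarrow> ennreal" and e c :: real
    assume g[measurable]: "g \<in> borel_measurable borel"
    let ?m = "sqmass {c - M..c + M} g"
    let ?D = "\<integral>\<^sup>+s. \<integral>\<^sup>+s'. shift_energy g (s - s') \<partial>law \<partial>law"
    let ?far = "\<lambda>s s'. indicator {s'. 1 / (4 * B) \<le> \<bar>s - s'\<bar>} s' :: ennreal"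
    have [measurable]: "(\<lambda>t. shift_energy g t) \<in> borel_measurable borel"
      unfolding shift_energy_def by measurable
    have [measurable]: "{s'. 1 / (4 * B) \<le> \<bar>s - s'\<bar>} \<in> sets borel" for s by measurable
    have "?m * ennreal (1/2) = (\<integral>\<^sup>+s. ?m * ennreal (1/2) \<partial>law)" by simp
    also have "\<dots> \<le> (\<integral>\<^sup>+s. ?m * (\<integral>\<^sup>+s'. ?far s s' \<partial>law) \<partial>law)"
      by (intro nn_integral_mono mult_left_mono law_far) auto
    also have "\<dots> = (\<integral>\<^sup>+s. \<integral>\<^sup>+s'. ?m * ?far s s' \<partial>law \<partial>law)"
      by (intro nn_integral_cong nn_integral_cmult[symmetric]) measurable
    also have "\<dots> \<le> (\<integral>\<^sup>+s. \<integral>\<^sup>+s'. ennreal (1/8) * sqnorm g + ennreal C * shift_energy g (s - s') \<partial>law \<partial>law)"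
    proof (intro nn_integral_mono)
      fix s s' :: real
      show "?m * ?far s s' \<le> ennreal (1/8) * sqnorm g + ennreal C * shift_energy g (s - s')"
      proof (cases "1 / (4 * B) \<le> \<bar>s - s'\<bar>")
        case True
        then have "real k * (1 / (4 * B)) \<le> real k * \<bar>s - s'\<bar>" by (intro mult_left_mono) auto
        then have "2 * M < real k * \<bar>s - s'\<bar>" using k by linarith
        then show ?thesis
          using sqmass_interval_le[of g M k "s - s'" c] True by (simp add: C_ennreal)
      qed simp
    qed
    also have "\<dots> = ennreal (1/8) * sqnorm g + ennreal C * ?D"
      by (simp add: nn_integral_add nn_integral_cmult)
    finally have half: "?m * ennreal (1/2) \<le> ennreal (1/8) * sqnorm g + ennreal C * ?D" .
    have two_half: "?m = 2 * (?m * ennreal (1/2))"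
    proof -
      have "ennreal 2 * ennreal (1/2) = ennreal (2 * (1/2))"
        by (rule ennreal_mult[symmetric]) auto
      then have "2 * ennreal (1/2) = 1" by simp
      then show ?thesis by (metis mult.left_commute mult.right_neutral)
    qed
    have "?m + ennreal (4 * C) * sqnorm (conv e g)
        \<le> 2 * (ennreal (1/8) * sqnorm g + ennreal C * ?D) + ennreal (4 * C) * sqnorm (conv e g)"
      by (subst two_half) (intro add_mono mult_left_mono half, auto)
    also have "\<dots> = ennreal (1/4) * sqnorm g + ennreal (2 * C) * (2 * sqnorm (conv e g) + ?D)"
    proof -
      have "2 * ennreal (1/8) = ennreal (1/4)" "2 * ennreal C = ennreal (2 * C)" "ennreal (2 * C) * 2 = ennreal (4 * C)"
        using \<open>C > 0\<close> by (simp_all flip: ennreal_numeral ennreal_mult)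
      moreover have "2 * (x * n + y * d) + z * k = x' * n + w * (2 * k + d)"
        if "2 * x = x'" "2 * y = w" "w * 2 = z" for x x' y z w n d k :: ennreal
        by (simp add: that[symmetric] distrib_left ac_simps)
      ultimately show ?thesis by blast
    qed
    also have "\<dots> = ennreal (1/4) * sqnorm g + ennreal (4 * C) * sqnorm g"
    proof -
      have "ennreal (2 * C) * 2 = ennreal (4 * C)"
        using \<open>C > 0\<close> by (simp flip: ennreal_numeral ennreal_mult)
      then have "ennreal (2 * C) * (2 * sqnorm g) = ennreal (4 * C) * sqnorm g"
        by (simp only: mult.assoc[symmetric])
      then show ?thesis by (simp only: conv_energy[OF g])
    qed
    also have "\<dots> = ennreal (1 / 4 + 4 * C) * sqnorm g"
      using \<open>C > 0\<close> by (simp add: distrib_right ennreal_plus)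
    finally show "?m + ennreal (4 * C) * sqnorm (conv e g) \<le> ennreal (1 / 4 + 4 * C) * sqnorm g" .
  qed
qed

end

section \<open>Area formula and inversion\<close>

text \<open>On the interval \<open>F\<close> is strictly increasing, so at most one point of
  \<open>X V\<close> lies in \<open>D\<close>, and it is recovered from \<open>V\<close> by an
  inverse of \<open>F\<close>. The sets \<open>X V\<close> carry no measurability in
  \<open>V\<close>; this is why a measurable majorant \<open>f\<close> with the right integral is
  produced.\<close>

lemma area_formula_interval_le:
  fixes F F' :: "real \<Rightarrow> real" and h :: "real \<Rightarrow> ennreal" and X :: "real \<Rightarrow> real set"
  assumes ab: "a < b"
    and F: "\<And>x. x \<in> {a..b} \<Longrightarrow> (F has_real_derivative F' x) (at x)"
    and F'_pos: "\<And>x. x \<in> {a..b} \<Longrightarrow> F' x > 0"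
    and cont: "continuous_on {a..b} F'"
    and [measurable]: "F' \<in> borel_measurable borel" "h \<in> borel_measurable borel" "D \<in> sets borel"
    and D: "D \<subseteq> {a..b}"
    and X: "\<And>V x. x \<in> X V \<Longrightarrow> F x = V"
  shows "\<exists>f. f \<in> borel_measurable borel \<and> (\<forall>V. (\<Sum>x\<in>X V \<inter> D. h x / ennreal (F' x)) \<le> f V)
    \<and> (\<integral>\<^sup>+V. f V \<partial>lborel) = (\<integral>\<^sup>+x. h x * indicator D x \<partial>lborel)"
proof -
  have less: "F x < F y" if "x \<in> {a..b}" "y \<in> {a..b}" "x < y" for x y
  proof (rule DERIV_pos_imp_increasing[OF \<open>x < y\<close>])
    fix w assume "x \<le> w" "w \<le> y"
    then have "w \<in> {a..b}" using that by auto
    then show "\<exists>l. (F has_real_derivative l) (at w) \<and> 0 < l" using F F'_pos by blast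
  qed
  \<comment> \<open>A generalized inverse defined on the whole line: inserting \<open>a\<close>
    keeps the set nonempty, and \<open>b\<close> bounds it. Being monotone, it is Borel
    measurable.\<close>
  define \<psi> where "\<psi> V = Sup (insert a {x\<in>{a..b}. F x \<le> V})" for V
  have "mono \<psi>"
  proof (rule monoI)
    fix V W :: real assume "V \<le> W"
    then show "\<psi> V \<le> \<psi> W"
      unfolding \<psi>_def using ab by (intro cSup_subset_mono) (auto intro!: bdd_aboveI[of _ b])
  qed
  then have [measurable]: "\<psi> \<in> borel_measurable borel" by (rule borel_measurable_mono)
  have \<psi>_F: "\<psi> (F x) = x" if "x \<in> {a..b}" for x
  proof -
    have "F y \<le> F x \<longleftrightarrow> y \<le> x" if "y \<in> {a..b}" for y
      using less[OF \<open>x \<in> {a..b}\<close> that] less[OF that \<open>x \<in> {a..b}\<close>] by (cases x y rule: linorder_cases) auto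
    then have "insert a {y\<in>{a..b}. F y \<le> F x} = {a..x}"
      using that by auto
    then show ?thesis using that by (simp add: \<psi>_def)
  qed
  define f where "f V = h (\<psi> V) / ennreal (F' (\<psi> V)) * indicator D (\<psi> V) * indicator {F a..F b} V" for V
  have "(\<Sum>x\<in>X V \<inter> D. h x / ennreal (F' x)) \<le> f V" for V
  proof (cases "X V \<inter> D = {}")
    case False
    then obtain x where x: "x \<in> X V" "x \<in> D" by auto
    then have xab: "x \<in> {a..b}" and V: "V = F x" using D X by auto
    have "X V \<inter> D = {x}"
    proof -
      have "y = x" if "y \<in> X V \<inter> D" for y
      proof -
        have "F y = F x" "y \<in> {a..b}" using that X D V by auto
        then show ?thesis using less[OF xab, of y] less[OF _ xab, of y] by (cases x y rule: linorder_cases) auto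
      qed
      then show ?thesis using x by blast
    qed
    moreover have "F a \<le> F x" using less[of a x] xab by (cases "a = x") auto
    moreover have "F x \<le> F b" using less[of x b] xab by (cases "x = b") auto
    ultimately show ?thesis using x xab by (simp add: f_def V \<psi>_F)
  qed simp
  moreover have "(\<integral>\<^sup>+V. f V \<partial>lborel)
      = (\<integral>\<^sup>+x. h (\<psi> (F x)) / ennreal (F' (\<psi> (F x))) * indicator D (\<psi> (F x)) * ennreal (F' x) * indicator {a..b} x \<partial>lborel)"
    unfolding f_def
  proof (rule nn_integral_substitution_aux[OF _ _ F cont _ ab])
    show "(\<lambda>V. h (\<psi> V) / ennreal (F' (\<psi> V)) * indicator D (\<psi> V)) \<in> borel_measurable borel"
      by measurable
    show "0 \<le> F' x" if "x \<in> {a..b}" for x using F'_pos[OF that] by simp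
  qed auto
  moreover have "\<dots> = (\<integral>\<^sup>+x. h x * indicator D x \<partial>lborel)"
  proof (intro nn_integral_cong)
    fix x
    show "h (\<psi> (F x)) / ennreal (F' (\<psi> (F x))) * indicator D (\<psi> (F x)) * ennreal (F' x) * indicator {a..b} x
        = h x * indicator D x"
    proof (cases "x \<in> D")
      case True
      then have "x \<in> {a..b}" using D by auto
      then show ?thesis using F'_pos[of x] True
        by (simp add: \<psi>_F ennreal_divide_times ennreal_mult_divide_eq ennreal_times_divide mult.commute)
    next
      case False
      then show ?thesis by (cases "x \<in> {a..b}") (auto simp: \<psi>_F)
    qed
  qed
  moreover have "f \<in> borel_measurable borel" unfolding f_def by measurable
  ultimately show ?thesis by metis
qed

text \<open>An open set is a countable union of compact rational intervals. Made disjoint, these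
  pieces reduce the claim to the strictly monotone case, and the majorants of the pieces are summed.
  The sets \<open>X V\<close> may omit solutions of \<open>F x = V\<close>, hence an
  inequality.\<close>

lemma area_formula_le:
  fixes F F' :: "real \<Rightarrow> real" and h :: "real \<Rightarrow> ennreal" and X :: "real \<Rightarrow> real set"
  assumes S: "open S"
    and F: "\<And>x. x \<in> S \<Longrightarrow> (F has_real_derivative F' x) (at x)"
    and F'_pos: "\<And>x. x \<in> S \<Longrightarrow> F' x > 0"
    and cont: "continuous_on S F'"
    and [measurable]: "F' \<in> borel_measurable borel" "h \<in> borel_measurable borel"
    and X: "\<And>V. finite (X V)" "\<And>V. X V \<subseteq> S" "\<And>V x. x \<in> X V \<Longrightarrow> F x = V"
  shows "(\<integral>\<^sup>+V. (\<Sum>x\<in>X V. h x / ennreal (F' x)) \<partial>lborel) \<le> (\<integral>\<^sup>+x. h x * indicator S x \<partial>lborel)"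
proof -
  \<comment> \<open>The degenerate pair \<open>(0, 0)\<close> makes \<open>R\<close> nonempty, so
    that it can be enumerated; it yields an empty interval in \<open>I\<close>.\<close>
  define R where "R = {(u, v). u \<in> \<rat> \<and> v \<in> \<rat> \<and> u < v \<and> {u..v} \<subseteq> S} \<union> {(u, v). u = 0 \<and> v = (0::real)}"
  have "countable (\<rat> \<times> \<rat> :: (real \<times> real) set)" by (intro countable_SIGMA countable_rat)
  then have "countable R"
    by (rule countable_subset[rotated]) (auto simp: R_def)
  moreover have "R \<noteq> {}" by (auto simp: R_def)
  ultimately obtain e :: "nat \<Rightarrow> real \<times> real" where e: "range e = R"
    by (metis range_from_nat_into)
  define I where "I n = (if fst (e n) < snd (e n) then {fst (e n)..snd (e n)} else {})" for n
  have I: "I n = {} \<or> (\<exists>u v. u < v \<and> {u..v} \<subseteq> S \<and> I n = {u..v})" for n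
  proof -
    have "e n \<in> R" using e by auto
    then show ?thesis by (auto simp: I_def R_def)
  qed
  have cover: "(\<Union>n. I n) = S"
  proof
    have "I n \<subseteq> S" for n using I[of n] by auto
    then show "(\<Union>n. I n) \<subseteq> S" by blast
    show "S \<subseteq> (\<Union>n. I n)"
    proof
      fix x assume "x \<in> S"
      then obtain \<epsilon> where \<epsilon>: "\<epsilon> > 0" "ball x \<epsilon> \<subseteq> S" using S openE by blast
      obtain u v where uv: "u \<in> \<rat>" "v \<in> \<rat>" "x - \<epsilon> < u" "u < x" "x < v" "v < x + \<epsilon>"
        using Rats_dense_in_real[of "x - \<epsilon>" x] Rats_dense_in_real[of x "x + \<epsilon>"] \<epsilon>(1) by auto
      have "{u..v} \<subseteq> ball x \<epsilon>" using uv by (auto simp: dist_real_def abs_if)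
      then have "(u, v) \<in> R" using uv \<epsilon> by (auto simp: R_def)
      then obtain n where "e n = (u, v)" using e by (metis imageE)
      then have "x \<in> I n" using uv by (auto simp: I_def)
      then show "x \<in> (\<Union>n. I n)" by auto
    qed
  qed
  have I_sets: "I n \<in> sets borel" for n using I[of n] by auto
  define D where "D = disjointed I"
  have D_sets[measurable]: "D n \<in> sets borel" for n
    unfolding D_def using I_sets by (meson image_subset_iff range_subsetD sets.range_disjointed_sets)
  have disj: "disjoint_family D" unfolding D_def by (rule disjoint_family_disjointed)
  have UN_D: "(\<Union>n. D n) = S" unfolding D_def by (simp add: UN_disjointed_eq cover)
  have D_I: "D n \<subseteq> I n" for n unfolding D_def by (rule disjointed_subset)
  have "\<exists>f. f \<in> borel_measurable borel \<and> (\<forall>V. (\<Sum>x\<in>X V \<inter> D n. h x / ennreal (F' x)) \<le> f V)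
    \<and> (\<integral>\<^sup>+V. f V \<partial>lborel) = (\<integral>\<^sup>+x. h x * indicator (D n) x \<partial>lborel)" for n
  proof (cases "I n = {}")
    case True
    then have "D n = {}" using D_I[of n] by auto
    then show ?thesis by (intro exI[of _ "\<lambda>_. 0"]) auto
  next
    case False
    then obtain u v where uv: "u < v" "{u..v} \<subseteq> S" "I n = {u..v}" using I by blast
    show ?thesis
    proof (rule area_formula_interval_le[OF uv(1)])
      show "(F has_real_derivative F' x) (at x)" "F' x > 0" if "x \<in> {u..v}" for x
        using that uv(2) F F'_pos by blast+
      show "continuous_on {u..v} F'" using cont uv(2) by (rule continuous_on_subset)
      show "D n \<subseteq> {u..v}" using D_I[of n] uv(3) by simp
    qed (use X(3) in auto)
  qed
  then obtain f where f: "\<And>n. f n \<in> borel_measurable borel"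
    "\<And>n V. (\<Sum>x\<in>X V \<inter> D n. h x / ennreal (F' x)) \<le> f n V"
    "\<And>n. (\<integral>\<^sup>+V. f n V \<partial>lborel) = (\<integral>\<^sup>+x. h x * indicator (D n) x \<partial>lborel)"
    by metis
  note f(1)[measurable]
  have le: "(\<Sum>x\<in>X V. h x / ennreal (F' x)) \<le> (\<Sum>n. f n V)" for V
  proof -
    define k where "k x = (SOME n. x \<in> D n)" for x
    have k: "x \<in> D (k x)" if "x \<in> X V" for x
    proof -
      have "\<exists>n. x \<in> D n" using that X(2) UN_D by blast
      then show ?thesis unfolding k_def by (rule someI_ex)
    qed
    have "(\<Sum>x\<in>X V. h x / ennreal (F' x)) = (\<Sum>n\<in>k ` X V. \<Sum>x\<in>{x \<in> X V. k x = n}. h x / ennreal (F' x))"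
      by (rule sum.image_gen) (rule X)
    also have "\<dots> \<le> (\<Sum>n\<in>k ` X V. \<Sum>x\<in>X V \<inter> D n. h x / ennreal (F' x))"
      by (intro sum_mono sum_mono2) (auto simp: X dest: k)
    also have "\<dots> \<le> (\<Sum>n\<in>k ` X V. f n V)" by (intro sum_mono f(2))
    also have "\<dots> \<le> (\<Sum>n. f n V)" by (intro sum_le_suminf) (auto simp: X)
    finally show ?thesis .
  qed
  have "(\<integral>\<^sup>+V. (\<Sum>x\<in>X V. h x / ennreal (F' x)) \<partial>lborel) \<le> (\<integral>\<^sup>+V. (\<Sum>n. f n V) \<partial>lborel)"
    by (intro nn_integral_mono le)
  also have "\<dots> = (\<Sum>n. \<integral>\<^sup>+x. h x * indicator (D n) x \<partial>lborel)"
    by (subst nn_integral_suminf) (auto simp: f(3))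
  also have "\<dots> = (\<integral>\<^sup>+x. (\<Sum>n. h x * indicator (D n) x) \<partial>lborel)"
    by (rule nn_integral_suminf[symmetric]) measurable
  also have "\<dots> = (\<integral>\<^sup>+x. h x * indicator S x \<partial>lborel)"
    by (simp add: suminf_indicator[OF disj] UN_D)
  finally show ?thesis .
qed

definition inversion :: "real \<Rightarrow> (real \<Rightarrow> ennreal) \<Rightarrow> real \<Rightarrow> ennreal" where
  "inversion b g z = ennreal (b / \<bar>z\<bar>) * g (b\<^sup>2 / z)"

lemma inversion_measurable [measurable]:
  assumes [measurable]: "g \<in> borel_measurable borel"
  shows "inversion b g \<in> borel_measurable borel"
  unfolding inversion_def by measurable

text \<open>The area formula is stated for increasing maps, and \<open>b\<^sup>2 / z\<close>
  decreases on both half-lines. It is therefore applied to \<open>- (b\<^sup>2 / x)\<close>,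
  followed by a reflection. At \<open>z = 0\<close> division by zero makes the left integrand
  vanish, in agreement with the empty set of preimages.\<close>

lemma nn_integral_inversion_le:
  fixes h :: "real \<Rightarrow> ennreal"
  assumes b: "b > 0" and [measurable]: "h \<in> borel_measurable borel"
  shows "(\<integral>\<^sup>+z. ennreal (b\<^sup>2 / z\<^sup>2) * h (b\<^sup>2 / z) \<partial>lborel) \<le> (\<integral>\<^sup>+y. h y \<partial>lborel)"
proof -
  let ?X = "\<lambda>V::real. if V = 0 then {} else {- (b\<^sup>2 / V)}"
  have "(\<integral>\<^sup>+z. ennreal (b\<^sup>2 / z\<^sup>2) * h (b\<^sup>2 / z) \<partial>lborel)
      = (\<integral>\<^sup>+V. (\<Sum>x\<in>?X V. h (- x) / ennreal (b\<^sup>2 / x\<^sup>2)) \<partial>lborel)"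
  proof (intro nn_integral_cong)
    fix z :: real
    show "ennreal (b\<^sup>2 / z\<^sup>2) * h (b\<^sup>2 / z) = (\<Sum>x\<in>?X z. h (- x) / ennreal (b\<^sup>2 / x\<^sup>2))"
    proof (cases "z = 0")
      case False
      have "b\<^sup>2 / (b\<^sup>2 / z)\<^sup>2 = z\<^sup>2 / b\<^sup>2"
        using b False by (simp add: power_divide power2_eq_square)
      moreover have "z\<^sup>2 / b\<^sup>2 > 0" using b False by simp
      ultimately have "inverse (ennreal (b\<^sup>2 / (b\<^sup>2 / z)\<^sup>2)) = ennreal (b\<^sup>2 / z\<^sup>2)"
        by (simp add: inverse_ennreal)
      then show ?thesis using False by (simp add: divide_ennreal_def mult.commute)
    qed simp
  qed
  also have "\<dots> \<le> (\<integral>\<^sup>+x. h (- x) * indicator (- {0}) x \<partial>lborel)"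
  proof (rule area_formula_le[where F = "\<lambda>x. - (b\<^sup>2 / x)"])
    show "((\<lambda>x. - (b\<^sup>2 / x)) has_real_derivative b\<^sup>2 / x\<^sup>2) (at x)" if "x \<in> - {0}" for x
      using that by (auto intro!: derivative_eq_intros simp: power2_eq_square)
    show "- (b\<^sup>2 / x) = V" if "x \<in> ?X V" for V x
      using that b by (auto split: if_splits)
  qed (use b in \<open>auto intro!: continuous_intros\<close>)
  also have "\<dots> \<le> (\<integral>\<^sup>+x. h (- x) \<partial>lborel)"
    by (intro nn_integral_mono) (auto simp: indicator_def)
  also have "\<dots> = (\<integral>\<^sup>+x. h x \<partial>lborel)"
    using nn_integral_lborel_reflect[of h 0] by simp
  finally show ?thesis .
qed

lemma sqnorm_inversion_le:
  assumes b: "b > 0" and [measurable]: "g \<in> borel_measurable borel"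
  shows "sqnorm (inversion b g) \<le> sqnorm g"
proof -
  have "sqnorm (inversion b g) = (\<integral>\<^sup>+z. ennreal (b\<^sup>2 / z\<^sup>2) * (g (b\<^sup>2 / z))\<^sup>2 \<partial>lborel)"
    using b by (simp add: sqnorm_def inversion_def power_mult_distrib ennreal_power power_divide)
  also have "\<dots> \<le> sqnorm g"
    unfolding sqnorm_def by (rule nn_integral_inversion_le[OF b]) measurable
  finally show ?thesis .
qed

text \<open>Inversion in the circle of radius \<open>b \<le> M\<close> moves the complement of \<open>{-M..M}\<close> into \<open>{-M..M}\<close>.\<close>

lemma sqnorm_le_sqmass_inversion:
  assumes b: "0 < b" "b \<le> M" and [measurable]: "g \<in> borel_measurable borel"
  shows "sqnorm g \<le> sqmass {- M..M} g + sqmass {- M..M} (inversion b g)"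
proof -
  have "sqnorm g = (\<integral>\<^sup>+x. (g x)\<^sup>2 * indicator {- M..M} x + (g x)\<^sup>2 * indicator (- {- M..M}) x \<partial>lborel)"
    unfolding sqnorm_def by (intro nn_integral_cong) (auto simp: indicator_def)
  also have "\<dots> = sqmass {- M..M} g + (\<integral>\<^sup>+x. (g x)\<^sup>2 * indicator (- {- M..M}) x \<partial>lborel)"
    unfolding sqmass_def by (rule nn_integral_add) auto
  \<comment> \<open>Inversion is an involution away from zero: applying it again at
    \<open>b\<^sup>2 / x\<close> recovers \<open>g x\<close>, and the Jacobian cancels the squared
    weight.\<close>
  also have "(\<integral>\<^sup>+x. (g x)\<^sup>2 * indicator (- {- M..M}) x \<partial>lborel)
      \<le> (\<integral>\<^sup>+z. ennreal (b\<^sup>2 / z\<^sup>2) * ((inversion b g (b\<^sup>2 / z))\<^sup>2 * indicator {- M..M} (b\<^sup>2 / z)) \<partial>lborel)"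
  proof (intro nn_integral_mono)
    fix x :: real
    show "(g x)\<^sup>2 * indicator (- {- M..M}) x
      \<le> ennreal (b\<^sup>2 / x\<^sup>2) * ((inversion b g (b\<^sup>2 / x))\<^sup>2 * indicator {- M..M} (b\<^sup>2 / x))"
    proof (cases "x \<in> {- M..M}")
      case False
      then have x: "\<bar>x\<bar> > M" "x \<noteq> 0" using b by auto
      have "\<bar>b\<^sup>2 / x\<bar> \<le> M"
      proof -
        have "b\<^sup>2 \<le> M * \<bar>x\<bar>" using b x by (simp add: power2_eq_square mult_mono)
        then show ?thesis using x by (simp add: abs_divide divide_le_eq)
      qed
      then have in_M: "b\<^sup>2 / x \<in> {- M..M}" unfolding abs_le_iff by simp
      have "ennreal (b\<^sup>2 / x\<^sup>2) * (ennreal (b / \<bar>b\<^sup>2 / x\<bar>))\<^sup>2 = 1"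
        using b x by (simp add: ennreal_power flip: ennreal_mult) (simp add: power2_eq_square field_simps)
      moreover have "b\<^sup>2 / (b\<^sup>2 / x) = x" using b x by simp
      ultimately have "ennreal (b\<^sup>2 / x\<^sup>2) * ((inversion b g (b\<^sup>2 / x))\<^sup>2 * indicator {- M..M} (b\<^sup>2 / x)) = (g x)\<^sup>2"
        using in_M by (simp add: inversion_def power_mult_distrib flip: mult.assoc)
      then show ?thesis by (simp add: indicator_def)
    qed simp
  qed
  also have "\<dots> \<le> sqmass {- M..M} (inversion b g)"
    unfolding sqmass_def
    by (rule nn_integral_inversion_le[OF b(1), of "\<lambda>y. (inversion b g y)\<^sup>2 * indicator {- M..M} y"]) measurable
  finally show ?thesis by (simp add: add_left_mono)
qed

section \<open>Strict contraction by two convolutions separated by an inversion\<close>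

context bounded_density
begin

text \<open>In the notation of the proof, \<open>h\<close> is the convolved input \<open>f\<close>
  and \<open>g\<close> its inversion. If both convolutions lost almost nothing, \<open>h\<close> and
  \<open>g\<close> would each have little more than a quarter of their squared norm on
  \<open>{- A..A}\<close>, while by \<open>sqnorm_le_sqmass_inversion\<close> these two masses add
  up to at least \<open>sqnorm h\<close>.\<close>

lemma conv_inversion_conv_contraction:
  assumes "A > 0"
  obtains \<kappa> :: real where "0 < \<kappa>" "\<kappa> < 1"
    "\<And>g b e e'. g \<in> borel_measurable borel \<Longrightarrow> 0 < b \<Longrightarrow> b \<le> A \<Longrightarrow>
      sqnorm (conv e (inversion b (conv e' g))) \<le> ennreal \<kappa> * sqnorm g"
proof -
  obtain K where K: "K > 0" "\<And>g e c. g \<in> borel_measurable borel \<Longrightarrow>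
      sqmass {c - A..c + A} g + ennreal K * sqnorm (conv e g) \<le> ennreal (1 / 4 + K) * sqnorm g"
    by (rule sqmass_add_sqnorm_conv_le[of A]) (rule that)
  show thesis
  \<comment> \<open>Adding facts 1, 2 and 3 cancels the interval masses and leaves
    \<open>3 / 4 * nh + K * nk \<le> (1 / 4 + K) * nf\<close>; with \<open>nk \<le> nh\<close> this
    is the quotient.\<close>
  proof (rule that[of "(1 / 4 + K) / (3 / 4 + K)"])
    show "0 < (1 / 4 + K) / (3 / 4 + K)" "(1 / 4 + K) / (3 / 4 + K) < 1" using K(1) by auto
    fix f :: "real \<Rightarrow> ennreal" and b e e' :: real
    assume f[measurable]: "f \<in> borel_measurable borel" and b: "0 < b" "b \<le> A"
    define h where "h = conv e' f"
    define g where "g = inversion b h"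
    have [measurable]: "h \<in> borel_measurable borel" "g \<in> borel_measurable borel"
      unfolding g_def h_def by measurable
    have h_f: "sqnorm h \<le> sqnorm f" unfolding h_def by (rule sqnorm_conv_le) measurable
    have g_h: "sqnorm g \<le> sqnorm h" unfolding g_def by (rule sqnorm_inversion_le[OF b(1)]) measurable
    have k_h: "sqnorm (conv e g) \<le> sqnorm h" by (rule order_trans[OF sqnorm_conv_le g_h]) measurable
    have 1: "sqmass {- A..A} g + ennreal K * sqnorm (conv e g) \<le> ennreal (1 / 4 + K) * sqnorm g"
      using K(2)[of g 0 e] by simp
    \<comment> \<open>To profit from the loss in the inner convolution, the mass of \<open>h\<close>
      is pulled back to \<open>f\<close>. The interval then has the random centre
      \<open>e' - s\<close>, which is why the constant \<open>K\<close> had to be uniform in the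
      centre.\<close>
    have 2: "sqmass {- A..A} h + ennreal K * sqnorm h \<le> ennreal (1 / 4 + K) * sqnorm f"
    proof -
      have vim: "(\<lambda>x. e' - s - x) -` {- A..A} = {e' - s - A..e' - s + A}" for s by auto
      have "sqmass {- A..A} h + ennreal K * sqnorm h
          \<le> (\<integral>\<^sup>+s. sqmass {e' - s - A..e' - s + A} f \<partial>law) + (\<integral>\<^sup>+s. ennreal K * sqnorm h \<partial>law)"
        using sqmass_conv_le[of f "{- A..A}" e'] by (simp add: h_def vim add_right_mono)
      also have "\<dots> = (\<integral>\<^sup>+s. sqmass {e' - s - A..e' - s + A} f + ennreal K * sqnorm h \<partial>law)"
      proof (rule nn_integral_add[symmetric])
        have "(\<lambda>s. sqmass {e' - s - A..e' - s + A} f)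
            = (\<lambda>s. \<integral>\<^sup>+x. (f x)\<^sup>2 * indicator {x. e' - s - A \<le> x \<and> x \<le> e' - s + A} x \<partial>lborel)"
          by (simp add: sqmass_def atLeastAtMost_def atLeast_def atMost_def Collect_conj_eq)
        also have "\<dots> \<in> borel_measurable law" by measurable
        finally show "(\<lambda>s. sqmass {e' - s - A..e' - s + A} f) \<in> borel_measurable law" .
      qed simp
      also have "\<dots> \<le> (\<integral>\<^sup>+s. ennreal (1 / 4 + K) * sqnorm f \<partial>law)"
        unfolding h_def by (intro nn_integral_mono K(2)) measurable
      finally show ?thesis by simp
    qed
    have 3: "sqnorm h \<le> sqmass {- A..A} h + sqmass {- A..A} g"
      unfolding g_def by (rule sqnorm_le_sqmass_inversion[OF b]) measurable
    show "sqnorm (conv e (inversion b (conv e' f))) \<le> ennreal ((1 / 4 + K) / (3 / 4 + K)) * sqnorm f"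
    proof (cases "sqnorm f = top")
      case True
      then show ?thesis using K(1) by (simp add: ennreal_mult_top)
    next
      case False
      then obtain nf where nf: "sqnorm f = ennreal nf" "0 \<le> nf" by (cases "sqnorm f") auto
      obtain nh where nh: "sqnorm h = ennreal nh" "0 \<le> nh"
        using h_f nf by (cases "sqnorm h") (auto simp: top_unique)
      obtain nk where nk: "sqnorm (conv e g) = ennreal nk" "0 \<le> nk"
        using k_h nh by (cases "sqnorm (conv e g)") (auto simp: top_unique)
      have "sqnorm h + ennreal K * sqnorm (conv e g) + ennreal K * sqnorm h
          \<le> (sqmass {- A..A} g + ennreal K * sqnorm (conv e g)) + (sqmass {- A..A} h + ennreal K * sqnorm h)"
        using add_right_mono[OF 3, of "ennreal K * sqnorm (conv e g) + ennreal K * sqnorm h"]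
        by (simp add: ac_simps)
      also have "\<dots> \<le> ennreal (1 / 4 + K) * sqnorm h + ennreal (1 / 4 + K) * sqnorm f"
        by (intro add_mono 2 order_trans[OF 1] mult_left_mono g_h) auto
      finally have "ennreal (nh + K * nk + K * nh) \<le> ennreal ((1 / 4 + K) * nh + (1 / 4 + K) * nf)"
        using K(1) nf nh nk by (simp flip: ennreal_mult ennreal_plus)
      then have "nh + K * nk + K * nh \<le> (1 / 4 + K) * nh + (1 / 4 + K) * nf"
        using K(1) nf nh nk by (subst (asm) ennreal_le_iff) auto
      moreover have "nk \<le> nh" using k_h nk nh by simp
      ultimately have "(3 / 4 + K) * nk \<le> (1 / 4 + K) * nf" by (simp add: algebra_simps)
      then have "nk \<le> (1 / 4 + K) / (3 / 4 + K) * nf" using K(1) by (simp add: field_simps)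
      then have "ennreal nk \<le> ennreal ((1 / 4 + K) / (3 / 4 + K)) * ennreal nf"
        using K(1) nf by (simp add: ennreal_leI flip: ennreal_mult)
      then show ?thesis using nf nk by (simp add: g_def h_def)
    qed
  qed
qed

end

section \<open>Orthogonal polynomials of a Jacobi matrix\<close>

text \<open>Solution of the three-term recursion \<open>b\<^sub>n u\<^sub>n\<^sub>+\<^sub>1 + v\<^sub>n u\<^sub>n + b\<^sub>n\<^sub>-\<^sub>1 u\<^sub>n\<^sub>-\<^sub>1 = x u\<^sub>n\<close> with
  \<open>u\<^sub>0 = 1\<close>, \<open>u\<^sub>-\<^sub>1 = 0\<close>.\<close>

fun opoly :: "(nat \<Rightarrow> 'a::field) \<Rightarrow> (nat \<Rightarrow> 'a) \<Rightarrow> nat \<Rightarrow> 'a poly" where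
  "opoly b v 0 = 1"
| "opoly b v (Suc 0) = smult (1 / b 0) [:- v 0, 1:]"
| "opoly b v (Suc (Suc n)) =
     smult (1 / b (Suc n)) ([:- v (Suc n), 1:] * opoly b v (Suc n) - smult (b n) (opoly b v n))"

lemma poly_opoly_1: "b 0 \<noteq> 0 \<Longrightarrow> b 0 * poly (opoly b v (Suc 0)) x = x - v 0"
  by (simp add: field_simps)

lemma poly_opoly_Suc_Suc:
  "b (Suc n) \<noteq> 0 \<Longrightarrow> b (Suc n) * poly (opoly b v (Suc (Suc n))) x
    = (x - v (Suc n)) * poly (opoly b v (Suc n)) x - b n * poly (opoly b v n) x"
  by (simp add: field_simps)

lemma degree_opoly:
  assumes "\<And>i. b i \<noteq> 0"
  shows "degree (opoly b v n) = n"
proof (induction n rule: induct_nat_012)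
  case (ge2 n)
  have "opoly b v (Suc n) \<noteq> 0" using ge2(2) by auto
  then have "degree ([:- v (Suc n), 1:] * opoly b v (Suc n)) = Suc (Suc n)"
    by (subst degree_mult_eq) (auto simp: ge2)
  moreover have "degree (smult (b n) (opoly b v n)) < Suc (Suc n)"
    using ge2(1) assms by simp
  ultimately have "degree ([:- v (Suc n), 1:] * opoly b v (Suc n) - smult (b n) (opoly b v n)) = Suc (Suc n)"
    by (metis degree_add_eq_left degree_minus diff_conv_add_uminus)
  then show ?case using assms by simp
qed (use assms in auto)

lemma opoly_neq_0: "(\<And>i. b i \<noteq> 0) \<Longrightarrow> opoly b v n \<noteq> 0"
  by (cases n) (use degree_opoly[where b = b and v = v and n = n] in auto)

lemma christoffel_darboux:
  assumes b: "\<And>i. b i \<noteq> 0"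
  shows "b n * (poly (opoly b v (Suc n)) x * poly (opoly b v n) y - poly (opoly b v n) x * poly (opoly b v (Suc n)) y)
    = (x - y) * (\<Sum>i\<le>n. poly (opoly b v i) x * poly (opoly b v i) y)"
proof (induction n)
  case 0
  have "b 0 * (poly (opoly b v (Suc 0)) x - poly (opoly b v (Suc 0)) y) = x - y"
    unfolding right_diff_distrib poly_opoly_1[where b = b, OF b] by simp
  then show ?case by simp
next
  case (Suc n)
  let ?p = "\<lambda>i. poly (opoly b v i)"
  have "b (Suc n) * (?p (Suc (Suc n)) x * ?p (Suc n) y - ?p (Suc n) x * ?p (Suc (Suc n)) y)
    = (b (Suc n) * ?p (Suc (Suc n)) x) * ?p (Suc n) y - ?p (Suc n) x * (b (Suc n) * ?p (Suc (Suc n)) y)"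
    by (simp add: algebra_simps)
  also have "\<dots> = (x - y) * (?p (Suc n) x * ?p (Suc n) y)
      + b n * (?p (Suc n) x * ?p n y - ?p n x * ?p (Suc n) y)"
    unfolding poly_opoly_Suc_Suc[where b = b, OF b] by (simp add: algebra_simps del: opoly.simps(2,3))
  also have "\<dots> = (x - y) * (\<Sum>i\<le>Suc n. ?p i x * ?p i y)"
    unfolding Suc by (simp add: algebra_simps del: opoly.simps(2,3))
  finally show ?case .
qed

text \<open>The confluent case \<open>y = x\<close> of the Christoffel-Darboux formula. Over the
  complex numbers it makes the roots simple; over the reals it gives the derivative of
  \<open>wratio\<close>.\<close>

lemma christoffel_darboux_deriv:
  assumes b: "\<And>i. b i \<noteq> 0"
  shows "b n * (poly (pderiv (opoly b v (Suc n))) x * poly (opoly b v n) x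
      - poly (pderiv (opoly b v n)) x * poly (opoly b v (Suc n)) x)
    = (\<Sum>i\<le>n. (poly (opoly b v i) x)\<^sup>2)"
proof (induction n)
  case 0
  show ?case using b[of 0] by (simp add: pderiv_smult pderiv_pCons)
next
  case (Suc n)
  let ?p = "\<lambda>i. poly (opoly b v i) x" and ?d = "\<lambda>i. poly (pderiv (opoly b v i)) x"
  have d: "b (Suc n) * ?d (Suc (Suc n)) = ?p (Suc n) + (x - v (Suc n)) * ?d (Suc n) - b n * ?d n"
    using b[of "Suc n"]
    by (simp add: pderiv_smult pderiv_diff pderiv_mult pderiv_pCons pderiv_add field_simps del: opoly.simps(2))
  have "b (Suc n) * (?d (Suc (Suc n)) * ?p (Suc n) - ?d (Suc n) * ?p (Suc (Suc n)))
    = (b (Suc n) * ?d (Suc (Suc n))) * ?p (Suc n) - ?d (Suc n) * (b (Suc n) * ?p (Suc (Suc n)))"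
    by (simp add: algebra_simps)
  also have "\<dots> = (?p (Suc n))\<^sup>2 + b n * (?d (Suc n) * ?p n - ?d n * ?p (Suc n))"
    unfolding d poly_opoly_Suc_Suc[where b = b, OF b] by (simp add: algebra_simps power2_eq_square del: opoly.simps(2,3))
  also have "\<dots> = (\<Sum>i\<le>Suc n. (?p i)\<^sup>2)"
    unfolding Suc by (simp del: opoly.simps(2,3))
  finally show ?case .
qed

lemma poly_opoly_of_real:
  "poly (opoly (\<lambda>i. complex_of_real (b i)) (\<lambda>i. complex_of_real (v i)) n) (of_real x) = of_real (poly (opoly b v n) x)"
  by (induction n rule: induct_nat_012) auto

lemma poly_opoly_cnj:
  "poly (opoly (\<lambda>i. complex_of_real (b i)) (\<lambda>i. complex_of_real (v i)) n) (cnj z)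
    = cnj (poly (opoly (\<lambda>i. complex_of_real (b i)) (\<lambda>i. complex_of_real (v i)) n) z)"
  by (induction n rule: induct_nat_012) auto

lemma sum_sq_opoly_pos: "(\<Sum>i<Suc n. (poly (opoly b v i) (x::real))\<^sup>2) > 0"
proof -
  have "(poly (opoly b v 0) x)\<^sup>2 \<le> (\<Sum>i<Suc n. (poly (opoly b v i) x)\<^sup>2)"
    by (rule member_le_sum) auto
  then show ?thesis by simp
qed

text \<open>For a root \<open>z\<close>, the Christoffel-Darboux formula at \<open>z\<close> and
  \<open>cnj z\<close> gives \<open>(z - cnj z)\<close> times a sum of squared moduli equal to zero.
  The sum is at least 1 because the polynomial of index 0 is 1, so \<open>z\<close> is real; the
  confluent formula then makes it simple. The fundamental theorem of algebra supplies the
  count.\<close>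

lemma card_opoly_roots:
  fixes b v :: "nat \<Rightarrow> real"
  assumes b: "\<And>i. b i > 0"
  shows "card {x. poly (opoly b v (Suc n)) x = 0} = Suc n"
proof -
  let ?p = "\<lambda>i. opoly (\<lambda>i. complex_of_real (b i)) (\<lambda>i. complex_of_real (v i)) i"
  have b': "(\<lambda>i. complex_of_real (b i)) i \<noteq> 0" for i using b[of i] by simp
  have sum_neq: "(\<Sum>i\<le>n. poly (?p i) z * poly (?p i) (cnj z)) \<noteq> 0" for z
  proof -
    have "(\<Sum>i\<le>n. poly (?p i) z * poly (?p i) (cnj z)) = of_real (\<Sum>i\<le>n. (cmod (poly (?p i) z))\<^sup>2)"
      by (simp only: poly_opoly_cnj of_real_sum complex_norm_square)
    moreover have "(cmod (poly (?p 0) z))\<^sup>2 \<le> (\<Sum>i\<le>n. (cmod (poly (?p i) z))\<^sup>2)"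
      by (rule member_le_sum) auto
    ultimately show ?thesis by (simp del: of_real_sum)
  qed
  have real: "z \<in> \<real>" if "poly (?p (Suc n)) z = 0" for z
  proof -
    have "poly (?p (Suc n)) (cnj z) = 0" using that poly_opoly_cnj[of b v "Suc n" z] by simp
    then have "(z - cnj z) * (\<Sum>i\<le>n. poly (?p i) z * poly (?p i) (cnj z)) = 0"
      using christoffel_darboux[where b = "\<lambda>i. complex_of_real (b i)", OF b', where n = n and v = "\<lambda>i. complex_of_real (v i)" and x = z and y = "cnj z"] that by simp
    then have "cnj z = z" using sum_neq[of z] by simp
    then show ?thesis by (simp add: Reals_cnj_iff)
  qed
  have "poly (pderiv (?p (Suc n))) z \<noteq> 0" if z: "poly (?p (Suc n)) z = 0" for z
  proof
    assume "poly (pderiv (?p (Suc n))) z = 0"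
    then have "(\<Sum>i\<le>n. (poly (?p i) z)\<^sup>2) = 0"
      using christoffel_darboux_deriv[where b = "\<lambda>i. complex_of_real (b i)", OF b', where n = n and v = "\<lambda>i. complex_of_real (v i)" and x = z] z by simp
    moreover have "cnj z = z" using real[OF z] by (simp add: Reals_cnj_iff)
    ultimately show False using sum_neq[of z] by (simp add: power2_eq_square)
  qed
  then have sqfree: "rsquarefree (?p (Suc n))" by (auto simp: rsquarefree_roots)
  have "Suc n = degree (?p (Suc n))" by (rule degree_opoly[where b = "\<lambda>i. complex_of_real (b i)", OF b', symmetric])
  also have "\<dots> = degree (smult (lead_coeff (?p (Suc n))) (\<Prod>z|poly (?p (Suc n)) z = 0. [:-z, 1:]))"
    using complex_poly_decompose_rsquarefree[OF sqfree] by simp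
  also have "\<dots> = card {z. poly (?p (Suc n)) z = 0}"
    using opoly_neq_0[where b = "\<lambda>i. complex_of_real (b i)", OF b', where n = "Suc n" and v = "\<lambda>i. complex_of_real (v i)"]
    by (simp add: degree_prod_eq_sum_degree del: opoly.simps)
  also have "{z. poly (?p (Suc n)) z = 0} = of_real ` {x. poly (opoly b v (Suc n)) x = 0}"
  proof (intro equalityI subsetI)
    fix z assume "z \<in> {z. poly (?p (Suc n)) z = 0}"
    then have z: "poly (?p (Suc n)) z = 0" by simp
    obtain t where t: "z = of_real t" using real[OF z] by (rule Reals_cases)
    have "poly (opoly b v (Suc n)) t = 0"
      using z poly_opoly_of_real[of b v "Suc n" t] by (simp only: t of_real_eq_0_iff)
    then show "z \<in> of_real ` {x. poly (opoly b v (Suc n)) x = 0}" using t by blast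
  qed (auto simp: poly_opoly_of_real simp del: opoly.simps)
  also have "card \<dots> = card {x. poly (opoly b v (Suc n)) x = 0}"
    by (rule card_image) (auto simp: inj_on_def)
  finally show ?thesis by simp
qed

lemma opoly_independent:
  assumes b: "\<And>i. b i \<noteq> 0" and "(\<Sum>i<n. smult (c i) (opoly b v i)) = 0" "j < n"
  shows "c j = 0"
  using assms(2,3)
proof (induction n)
  case (Suc n)
  have "coeff (\<Sum>i<n. smult (c i) (opoly b v i)) n = 0"
    using degree_opoly[where b = b, OF b, where v = v] by (auto simp: coeff_sum intro!: sum.neutral coeff_eq_0)
  then have "c n * coeff (opoly b v n) n = 0"
    using arg_cong[OF Suc.prems(1), of "\<lambda>p. coeff p n"]
    by (simp only: sum.lessThan_Suc coeff_add coeff_smult coeff_0 add_0)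
  moreover have "coeff (opoly b v n) n \<noteq> 0"
    using leading_coeff_0_iff[of "opoly b v n"] opoly_neq_0[where b = b and v = v and n = n, OF b]
      degree_opoly[where b = b and v = v and n = n, OF b] by simp
  ultimately have cn: "c n = 0" by simp
  show ?case
  proof (cases "j = n")
    case False
    then show ?thesis using Suc cn by simp
  qed (simp add: cn)
qed simp

text \<open>Christoffel-Darboux makes the vectors of polynomial values at distinct roots orthogonal.
  The deviation \<open>q\<close> from the claimed expansion thus vanishes at all
  \<open>n + 1\<close> roots while its degree is at most \<open>n\<close>, so it is zero, and linear
  independence gives its coefficients.\<close>

lemma opoly_completeness:
  fixes b v :: "nat \<Rightarrow> real"
  assumes b: "\<And>i. b i > 0" and i: "i < Suc n" and j: "j < Suc n"
  defines "S \<equiv> {x. poly (opoly b v (Suc n)) x = 0}"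
    and "w \<equiv> \<lambda>x. \<Sum>i<Suc n. (poly (opoly b v i) x)\<^sup>2"
  shows "(\<Sum>x\<in>S. poly (opoly b v i) x * poly (opoly b v j) x / w x) = (if i = j then 1 else 0)"
proof -
  have b0: "b i \<noteq> 0" for i using b[of i] by simp
  have fin: "finite S" unfolding S_def by (rule poly_roots_finite) (rule opoly_neq_0[where b = b, OF b0])
  have w: "w x \<noteq> 0" for x unfolding w_def using sum_sq_opoly_pos[where b = b and v = v and x = x and n = n] by simp
  have orth: "(\<Sum>i<Suc n. poly (opoly b v i) x * poly (opoly b v i) y) = (if x = y then w x else 0)"
    if "x \<in> S" "y \<in> S" for x y
    using christoffel_darboux[where b = b, OF b0, where n = n and v = v and x = x and y = y] that
    by (auto simp: S_def w_def power2_eq_square lessThan_Suc_atMost simp del: opoly.simps)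
  define c where "c i = (\<Sum>x\<in>S. poly (opoly b v i) x * poly (opoly b v j) x / w x)" for i
  define q where "q = (\<Sum>i<Suc n. smult (c i - (if i = j then 1 else 0)) (opoly b v i))"
  have q_alt: "poly q y = (\<Sum>i<Suc n. c i * poly (opoly b v i) y) - poly (opoly b v j) y" for y
    using j by (simp add: q_def poly_sum left_diff_distrib sum_subtractf if_distrib[of "\<lambda>z. z * _"] sum.delta'
      del: opoly.simps sum.lessThan_Suc cong: if_cong)
  have "poly q y = 0" if "y \<in> S" for y
  proof -
    have "(\<Sum>i<Suc n. c i * poly (opoly b v i) y)
        = (\<Sum>x\<in>S. poly (opoly b v j) x / w x * (\<Sum>i<Suc n. poly (opoly b v i) x * poly (opoly b v i) y))"
      unfolding c_def sum_distrib_left sum_distrib_right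
      by (subst sum.swap) (simp add: ac_simps del: opoly.simps sum.lessThan_Suc)
    also have "\<dots> = (\<Sum>x\<in>S. if x = y then poly (opoly b v j) x else 0)"
      using that w by (intro sum.cong refl) (simp add: orth del: opoly.simps sum.lessThan_Suc)
    also have "\<dots> = poly (opoly b v j) y" using fin that by (simp add: sum.delta)
    finally show ?thesis by (simp add: q_alt)
  qed
  then have sub: "S \<subseteq> {x. poly q x = 0}" by auto
  have "degree q < Suc n"
    unfolding q_def
    by (intro degree_sum_less) (auto simp: degree_opoly[where b = b, OF b0] intro!: le_less_trans[OF degree_smult_le])
  have "q = 0"
  proof (rule ccontr)
    assume q: "q \<noteq> 0"
    then have "card S \<le> card {x. poly q x = 0}" by (intro card_mono sub poly_roots_finite)
    also have "\<dots> \<le> degree q" by (rule card_poly_roots_bound[OF q])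
    finally show False using \<open>degree q < Suc n\<close> card_opoly_roots[where b = b, OF b, where v = v and n = n] by (simp add: S_def)
  qed
  then have "c i - (if i = j then 1 else 0) = 0"
    unfolding q_def by (rule opoly_independent[where b = b, OF b0 _ i])
  then show ?thesis by (simp add: c_def)
qed

section \<open>Spectral resolution in a finite box\<close>

text \<open>With the hopping terms across the boundary set to zero, the Jacobi matrix decouples and its
  block on \<open>{lo..hi}\<close> is the finite-volume operator.\<close>

definition hop_box :: "int \<Rightarrow> int \<Rightarrow> (int \<Rightarrow> real) \<Rightarrow> int \<Rightarrow> real" where
  "hop_box lo hi a n = (if lo \<le> n \<and> n < hi then a n else 0)"

lemma jac_pow_Suc:
  "jac_pow a \<omega> (Suc k) m n
    = a m * jac_pow a \<omega> k (m + 1) n + a (m - 1) * jac_pow a \<omega> k (m - 1) n + \<omega> m * jac_pow a \<omega> k m n"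
proof -
  have "{m - 1..m + 1} = {m - 1, m, m + 1}" by auto
  then show ?thesis by (simp add: jac_entry_def)
qed

text \<open>The diagonalization is explicit: the eigenvalues are the roots of the polynomial one
  index past the box, and the eigenvectors are the normalized polynomial values. Completeness is the
  case \<open>k = 0\<close> of the power formula; the eigenvalue equation gives the induction
  step.\<close>

lemma jacobi_box_spectral_resolution:
  fixes a \<omega> :: "int \<Rightarrow> real"
  assumes a: "\<And>n. a n > 0" and le: "lo \<le> hi"
  shows "\<exists>(S::real set) \<phi>. finite S \<and>
    (\<forall>E\<in>S. \<forall>m\<in>{lo..hi}. hop_box lo hi a m * \<phi> E (m + 1) + hop_box lo hi a (m - 1) * \<phi> E (m - 1) + \<omega> m * \<phi> E m = E * \<phi> E m) \<and>
    (\<forall>E\<in>S. (\<Sum>m\<in>{lo..hi}. (\<phi> E m)\<^sup>2) = 1) \<and>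
    (\<forall>k. \<forall>m\<in>{lo..hi}. \<forall>n\<in>{lo..hi}. jac_pow (hop_box lo hi a) \<omega> k m n = (\<Sum>E\<in>S. E ^ k * (\<phi> E m * \<phi> E n)))"
proof -
  define b where "b i = a (lo + int i)" for i
  define v where "v i = \<omega> (lo + int i)" for i
  define N where "N = nat (hi - lo)"
  define P where "P i = poly (opoly b v i)" for i
  define S where "S = {x. P (Suc N) x = 0}"
  define w where "w x = (\<Sum>i<Suc N. (P i x)\<^sup>2)" for x
  define \<phi> where "\<phi> x m = P (nat (m - lo)) x / sqrt (w x)" for x m
  have b: "b i > 0" for i using a by (simp add: b_def)
  then have b0: "b i \<noteq> 0" for i by (simp add: less_imp_neq[symmetric])
  have fin: "finite S"
    unfolding S_def P_def by (rule poly_roots_finite) (rule opoly_neq_0[where b = b, OF b0])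
  have w: "w x > 0" for x unfolding w_def P_def by (rule sum_sq_opoly_pos)
  have eig: "hop_box lo hi a m * \<phi> E (m + 1) + hop_box lo hi a (m - 1) * \<phi> E (m - 1) + \<omega> m * \<phi> E m = E * \<phi> E m"
    if E: "E \<in> S" and m: "m \<in> {lo..hi}" for E m
  proof -
    define i where "i = nat (m - lo)"
    have mi: "m = lo + int i" using m by (simp add: i_def)
    \<comment> \<open>At \<open>m = hi\<close> both sides vanish, the left by the cut hopping and
      the right because \<open>E\<close> is a root: vanishing of the next polynomial is the boundary
      condition.\<close>
    have up: "hop_box lo hi a m * P (nat (m + 1 - lo)) E = b i * P (Suc i) E"
    proof (cases "m < hi")
      case True
      have "nat (m + 1 - lo) = Suc i" using mi by simp
      then show ?thesis using True m by (simp add: hop_box_def b_def mi)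
    next
      case False
      then have "i = N" using m by (simp add: i_def N_def)
      then show ?thesis using False E by (simp add: hop_box_def S_def)
    qed
    have "b i * P (Suc i) E + hop_box lo hi a (m - 1) * P (nat (m - 1 - lo)) E + \<omega> m * P i E = E * P i E"
    proof (cases i)
      case 0
      then show ?thesis
        using poly_opoly_1[where b = b and v = v and x = E, OF b0] mi
        by (simp add: hop_box_def P_def v_def del: opoly.simps(2))
    next
      case (Suc k)
      then have "hop_box lo hi a (m - 1) = b k" "nat (m - 1 - lo) = k" "\<omega> m = v (Suc k)"
        using mi m by (auto simp: hop_box_def b_def v_def algebra_simps)
      then show ?thesis
        using poly_opoly_Suc_Suc[where b = b and v = v and x = E and n = k, OF b0] Suc
        by (simp add: P_def left_diff_distrib del: opoly.simps(2,3))
    qed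
    then show ?thesis using w[of E] unfolding \<phi>_def up[symmetric] i_def[symmetric]
      by (simp add: field_simps)
  qed
  have norm: "(\<Sum>m\<in>{lo..hi}. (\<phi> E m)\<^sup>2) = 1" for E
  proof -
    have "(\<Sum>m\<in>{lo..hi}. (\<phi> E m)\<^sup>2) = (\<Sum>i<Suc N. (P i E)\<^sup>2 / w E)"
      by (rule sum.reindex_bij_witness[of _ "\<lambda>i. lo + int i" "\<lambda>m. nat (m - lo)"])
        (use le w[of E] in \<open>auto simp: N_def \<phi>_def power_divide less_imp_le\<close>)
    also have "\<dots> = w E / w E" unfolding w_def sum_divide_distrib ..
    finally show ?thesis using w[of E] by simp
  qed
  have "jac_pow (hop_box lo hi a) \<omega> k m n = (\<Sum>E\<in>S. E ^ k * (\<phi> E m * \<phi> E n))"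
    if "m \<in> {lo..hi}" and n: "n \<in> {lo..hi}" for k m n
    using that(1)
  proof (induction k arbitrary: m)
    case 0
    have prod: "\<phi> E m * \<phi> E n = P (nat (m - lo)) E * P (nat (n - lo)) E / w E" for E
      using w[of E] by (simp add: \<phi>_def)
    have "(\<Sum>E\<in>S. \<phi> E m * \<phi> E n) = (if nat (m - lo) = nat (n - lo) then 1 else 0)"
      unfolding prod unfolding S_def P_def w_def
      by (rule opoly_completeness[where b = b, OF b]) (use 0 n in \<open>auto simp: N_def\<close>)
    then show ?case using 0 n by auto
  next
    case (Suc k)
    let ?T = "hop_box lo hi a"
    have summand: "t * jac_pow ?T \<omega> k j n = (\<Sum>E\<in>S. E ^ k * (t * \<phi> E j * \<phi> E n))"
      if "j \<in> {lo..hi} \<or> t = 0" for t j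
    proof (cases "t = 0")
      case False
      then have "j \<in> {lo..hi}" using that by simp
      from Suc.IH[OF this] show ?thesis
        by (simp only: sum_distrib_left) (intro sum.cong refl, simp only: ac_simps)
    qed simp
    have "jac_pow ?T \<omega> (Suc k) m n = (\<Sum>E\<in>S. E ^ k * (?T m * \<phi> E (m + 1) * \<phi> E n))
        + (\<Sum>E\<in>S. E ^ k * (?T (m - 1) * \<phi> E (m - 1) * \<phi> E n)) + (\<Sum>E\<in>S. E ^ k * (\<omega> m * \<phi> E m * \<phi> E n))"
    proof -
      have "m + 1 \<in> {lo..hi} \<or> ?T m = 0" "m - 1 \<in> {lo..hi} \<or> ?T (m - 1) = 0"
        using Suc.prems by (auto simp: hop_box_def)
      then show ?thesis unfolding jac_pow_Suc using Suc.prems by (simp only: summand simp_thms)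
    qed
    also have "\<dots> = (\<Sum>E\<in>S. E ^ k * ((?T m * \<phi> E (m + 1) + ?T (m - 1) * \<phi> E (m - 1) + \<omega> m * \<phi> E m) * \<phi> E n))"
      unfolding sum.distrib[symmetric] by (intro sum.cong refl) (simp add: algebra_simps)
    also have "\<dots> = (\<Sum>E\<in>S. E ^ Suc k * (\<phi> E m * \<phi> E n))"
    proof (intro sum.cong refl)
      fix E assume "E \<in> S"
      then show "E ^ k * ((?T m * \<phi> E (m + 1) + ?T (m - 1) * \<phi> E (m - 1) + \<omega> m * \<phi> E m) * \<phi> E n)
          = E ^ Suc k * (\<phi> E m * \<phi> E n)"
        unfolding eig[OF \<open>E \<in> S\<close> Suc.prems] by simp
    qed
    finally show ?case .
  qed
  note pow = this
  show ?thesis by (intro exI[of _ S] exI[of _ \<phi>] conjI ballI allI fin eig norm pow)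
qed

section \<open>Time-uniform bounds and the energy window\<close>

lemma norm_evol_entry_le:
  fixes S :: "real set"
  assumes "finite S" and pow: "\<And>k. jac_pow a \<omega> k m n = (\<Sum>E\<in>S. E ^ k * c E)"
  shows "cmod (evol_entry a \<omega> t m n) \<le> (\<Sum>E\<in>S. \<bar>c E\<bar>)"
proof -
  have "(\<lambda>k. (- \<i> * complex_of_real t) ^ k / of_nat (fact k) * complex_of_real (E ^ k * c E))
      sums (exp (- \<i> * complex_of_real t * complex_of_real E) * complex_of_real (c E))" for E
  proof -
    have "z ^ k / of_nat (fact k) * complex_of_real (E ^ k * c E)
        = (z * complex_of_real E) ^ k /\<^sub>R fact k * complex_of_real (c E)" for z k
      by (simp add: power_mult_distrib scaleR_conv_of_real divide_inverse)
    then show ?thesis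
      by (simp only: sums_mult2[OF exp_converges])
  qed
  then have "(\<lambda>k. \<Sum>E\<in>S. (- \<i> * complex_of_real t) ^ k / of_nat (fact k) * complex_of_real (E ^ k * c E))
      sums (\<Sum>E\<in>S. exp (- \<i> * complex_of_real t * complex_of_real E) * complex_of_real (c E))"
    by (intro sums_sum)
  moreover have "(\<lambda>k. \<Sum>E\<in>S. (- \<i> * complex_of_real t) ^ k / of_nat (fact k) * complex_of_real (E ^ k * c E))
      = (\<lambda>k. (- \<i> * complex_of_real t) ^ k / of_nat (fact k) * complex_of_real (jac_pow a \<omega> k m n))"
    by (simp only: pow of_real_sum sum_distrib_left)
  ultimately have "evol_entry a \<omega> t m n = (\<Sum>E\<in>S. exp (- \<i> * complex_of_real t * complex_of_real E) * complex_of_real (c E))"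
    unfolding evol_entry_def by (simp add: sums_iff)
  also have "cmod \<dots> \<le> (\<Sum>E\<in>S. cmod (exp (- \<i> * complex_of_real t * complex_of_real E) * complex_of_real (c E)))"
    by (rule norm_sum)
  also have "\<dots> = (\<Sum>E\<in>S. \<bar>c E\<bar>)"
    by (simp add: norm_mult)
  finally show ?thesis .
qed

text \<open>Gershgorin's argument: the eigenvalue equation is read at a site where
  \<open>\<bar>\<phi>\<bar>\<close> is maximal in the box. The resulting window for \<open>E\<close>
  depends neither on the box nor on the other details of the potential.\<close>

lemma jacobi_box_eigenvalue_le:
  fixes \<phi> :: "int \<Rightarrow> real"
  assumes eig: "\<And>m. m \<in> {lo..hi} \<Longrightarrow>
      hop_box lo hi a m * \<phi> (m + 1) + hop_box lo hi a (m - 1) * \<phi> (m - 1) + \<omega> m * \<phi> m = E * \<phi> m"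
    and nz: "k \<in> {lo..hi}" "\<phi> k \<noteq> 0"
    and A: "\<And>n. \<bar>a n\<bar> \<le> A" and M: "\<And>n. n \<in> {lo..hi} \<Longrightarrow> \<bar>\<omega> n\<bar> \<le> M"
  shows "\<bar>E\<bar> \<le> M + 2 * A"
proof -
  have "Max ((\<lambda>n. \<bar>\<phi> n\<bar>) ` {lo..hi}) \<in> (\<lambda>n. \<bar>\<phi> n\<bar>) ` {lo..hi}"
    using nz(1) by (intro Max_in) auto
  then obtain m where m1: "m \<in> {lo..hi}" "Max ((\<lambda>n. \<bar>\<phi> n\<bar>) ` {lo..hi}) = \<bar>\<phi> m\<bar>" by blast
  have m2: "\<bar>\<phi> n\<bar> \<le> \<bar>\<phi> m\<bar>" if "n \<in> {lo..hi}" for n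
    using that unfolding m1(2)[symmetric] by auto
  note m = m1(1) m2
  have pos: "\<bar>\<phi> m\<bar> > 0" using m(2)[OF nz(1)] nz(2) by linarith
  have "A \<ge> 0" using A[of 0] by linarith
  have up: "\<bar>hop_box lo hi a m * \<phi> (m + 1)\<bar> \<le> A * \<bar>\<phi> m\<bar>"
    using m(1) m(2)[of "m + 1"] A[of m] \<open>A \<ge> 0\<close> by (auto simp: hop_box_def abs_mult intro: mult_mono)
  have down: "\<bar>hop_box lo hi a (m - 1) * \<phi> (m - 1)\<bar> \<le> A * \<bar>\<phi> m\<bar>"
    using m(1) m(2)[of "m - 1"] A[of "m - 1"] \<open>A \<ge> 0\<close> by (auto simp: hop_box_def abs_mult intro: mult_mono)
  have diag: "\<bar>\<omega> m * \<phi> m\<bar> \<le> M * \<bar>\<phi> m\<bar>"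
    using M[OF m(1)] by (simp add: abs_mult mult_right_mono)
  have "\<bar>E\<bar> * \<bar>\<phi> m\<bar> = \<bar>hop_box lo hi a m * \<phi> (m + 1) + hop_box lo hi a (m - 1) * \<phi> (m - 1) + \<omega> m * \<phi> m\<bar>"
    unfolding eig[OF m(1)] by (simp add: abs_mult)
  also have "\<dots> \<le> A * \<bar>\<phi> m\<bar> + A * \<bar>\<phi> m\<bar> + M * \<bar>\<phi> m\<bar>"
    using up down diag by linarith
  finally have "\<bar>E\<bar> * \<bar>\<phi> m\<bar> \<le> (M + 2 * A) * \<bar>\<phi> m\<bar>" by (simp add: algebra_simps)
  then show ?thesis using pos by simp
qed

text \<open>The recursion is assumed only up to \<open>K\<close>, so that it applies separately to
  the pieces of an eigenvector on the two sides of a site.\<close>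

lemma opoly_unique:
  fixes f :: "nat \<Rightarrow> 'a::field"
  assumes b: "\<And>i. b i \<noteq> 0"
    and f1: "K \<ge> 1 \<Longrightarrow> b 0 * f 1 = (x - v 0) * f 0"
    and fSS: "\<And>k. Suc (Suc k) \<le> K \<Longrightarrow> b (Suc k) * f (Suc (Suc k)) = (x - v (Suc k)) * f (Suc k) - b k * f k"
    and "i \<le> K"
  shows "f i = f 0 * poly (opoly b v i) x"
  using \<open>i \<le> K\<close>
proof (induction i rule: induct_nat_012)
  case 1
  then have "b 0 * f 1 = b 0 * (f 0 * poly (opoly b v 1) x)"
    using f1 poly_opoly_1[where b = b and v = v and x = x, OF b] by (simp add: mult.left_commute del: opoly.simps(2))
  then show ?case using b[of 0] by (simp del: opoly.simps(2))
next
  case (ge2 k)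
  have "b (Suc k) * f (Suc (Suc k)) = (x - v (Suc k)) * f (Suc k) - b k * f k"
    using ge2.prems by (rule fSS)
  also have "\<dots> = f 0 * ((x - v (Suc k)) * poly (opoly b v (Suc k)) x - b k * poly (opoly b v k) x)"
    using ge2 by (simp add: algebra_simps del: opoly.simps(2,3))
  also have "\<dots> = b (Suc k) * (f 0 * poly (opoly b v (Suc (Suc k))) x)"
    unfolding poly_opoly_Suc_Suc[where b = b and v = v and x = x and n = k, OF b, symmetric] by (simp add: mult.left_commute)
  finally show ?case using b[of "Suc k"] by (simp del: opoly.simps(2,3))
qed simp

section \<open>Riccati variables\<close>

text \<open>The term through which the first \<open>n\<close> sites enter the equation at the next
  one: hopping times the value at the outer neighbour, divided by the value at the site itself. With
  no sites it is zero, the boundary condition.\<close>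

fun wratio :: "(nat \<Rightarrow> real) \<Rightarrow> (nat \<Rightarrow> real) \<Rightarrow> nat \<Rightarrow> real \<Rightarrow> real" where
  "wratio b v 0 x = 0"
| "wratio b v (Suc k) x = b k * poly (opoly b v k) x / poly (opoly b v (Suc k)) x"

text \<open>The Riccati form of \<open>wratio\<close>. Both agree where no \<open>opoly\<close> vanishes, that is, for all but finitely many
  \<open>x\<close>; at the exceptional points division by zero gives junk values.\<close>

fun ric :: "(nat \<Rightarrow> real) \<Rightarrow> (nat \<Rightarrow> real) \<Rightarrow> real \<Rightarrow> nat \<Rightarrow> real" where
  "ric b v x 0 = 0"
| "ric b v x (Suc k) = (b k)\<^sup>2 / (x - v k - ric b v x k)"

text \<open>Squared mass of the solution on the first \<open>n\<close> sites relative to its squared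
  value at the next one. It is the negative derivative of \<open>wratio\<close>, which links the
  Jacobian of spectral averaging to the normalization of eigenvectors.\<close>

definition wnorm :: "(nat \<Rightarrow> real) \<Rightarrow> (nat \<Rightarrow> real) \<Rightarrow> nat \<Rightarrow> real \<Rightarrow> real" where
  "wnorm b v n x = (\<Sum>i<n. (poly (opoly b v i) x)\<^sup>2) / (poly (opoly b v n) x)\<^sup>2"

lemma wratio_deriv:
  assumes b: "\<And>i. b i \<noteq> 0" and nz: "poly (opoly b v n) x \<noteq> 0"
  shows "(wratio b v n has_real_derivative - wnorm b v n x) (at x)"
proof (cases n)
  case 0
  have "wratio b v 0 = (\<lambda>_. 0)" by auto
  then show ?thesis using 0 by (simp add: wnorm_def)
next
  case (Suc k)
  let ?p = "\<lambda>i. poly (opoly b v i)" and ?d = "\<lambda>i. poly (pderiv (opoly b v i))"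
  have nz': "?p (Suc k) x \<noteq> 0" using nz by (simp only: Suc not_False_eq_True)
  have "((\<lambda>x. b k * ?p k x / ?p (Suc k) x) has_real_derivative
      (b k * ?d k x * ?p (Suc k) x - b k * ?p k x * ?d (Suc k) x) / (?p (Suc k) x * ?p (Suc k) x)) (at x)"
    by (intro DERIV_divide DERIV_cmult poly_DERIV nz')
  moreover have "(b k * ?d k x * ?p (Suc k) x - b k * ?p k x * ?d (Suc k) x)
      = - (b k * (?d (Suc k) x * ?p k x - ?d k x * ?p (Suc k) x))"
    by (simp only: right_diff_distrib minus_diff_eq mult_ac)
  moreover have "\<dots> = - (\<Sum>i<Suc k. (?p i x)\<^sup>2)"
    unfolding lessThan_Suc_atMost christoffel_darboux_deriv[where b = b, OF b] ..
  moreover have "wratio b v (Suc k) = (\<lambda>x. b k * ?p k x / ?p (Suc k) x)"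
    by (rule ext) (simp only: wratio.simps)
  ultimately show ?thesis
    by (simp only: Suc wnorm_def power2_eq_square minus_divide_left)
qed

lemma ric_eq_wratio:
  assumes b: "\<And>i. b i \<noteq> 0" and "\<And>i. i \<le> n \<Longrightarrow> poly (opoly b v i) x \<noteq> 0"
  shows "ric b v x n = wratio b v n x"
  using assms(2)
proof (induction n)
  case (Suc n)
  let ?p = "\<lambda>i. poly (opoly b v i) x"
  have IH: "ric b v x n = wratio b v n x" using Suc by simp
  have nz: "?p n \<noteq> 0" "?p (Suc n) \<noteq> 0" using Suc.prems[of n] Suc.prems[of "Suc n"] by (simp_all del: opoly.simps)
  have "b n * ?p (Suc n) = ?p n * (x - v n - wratio b v n x)"
  proof (cases n)
    case 0
    then show ?thesis using poly_opoly_1[where b = b and v = v and x = x, OF b] by (simp del: opoly.simps(2))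
  next
    case (Suc k)
    have "?p (Suc k) * wratio b v (Suc k) x = b k * ?p k"
      using nz(1) unfolding Suc by (simp del: opoly.simps(2,3))
    then show ?thesis
      unfolding Suc poly_opoly_Suc_Suc[where b = b, OF b] by (simp add: algebra_simps del: opoly.simps(2,3) wratio.simps(2))
  qed
  then have "x - v n - wratio b v n x = b n * ?p (Suc n) / ?p n"
    using nz by (simp add: field_simps del: opoly.simps)
  then have "ric b v x (Suc n) = (b n)\<^sup>2 / (b n * ?p (Suc n) / ?p n)"
    by (simp only: ric.simps IH)
  also have "\<dots> = b n * ?p n / ?p (Suc n)"
    using nz b[of n] by (simp add: power2_eq_square field_simps del: opoly.simps)
  finally show ?case by (simp only: wratio.simps)
qed simp

text \<open>The ratio telescopes, and each factor \<open>\<bar>ric b v x (Suc i)\<bar> / b i\<close>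
  is the ratio of two consecutive values.\<close>

lemma poly_ratio_eq_prod_ric:
  assumes b: "\<And>i. b i > 0" and nz: "\<And>i. i \<le> n \<Longrightarrow> poly (opoly b v i) x \<noteq> 0" and "k \<le> n"
  shows "\<bar>poly (opoly b v k) x / poly (opoly b v n) x\<bar> = (\<Prod>i\<in>{k..<n}. \<bar>ric b v x (Suc i)\<bar> / b i)"
  using \<open>k \<le> n\<close> nz
proof (induction n rule: dec_induct)
  case base
  then show ?case by (simp del: opoly.simps)
next
  case (step n)
  let ?p = "\<lambda>i. poly (opoly b v i) x"
  have b0: "b i \<noteq> 0" for i using b[of i] by simp
  have nz: "?p n \<noteq> 0" "?p (Suc n) \<noteq> 0" using step.prems[of n] step.prems[of "Suc n"] by (simp_all del: opoly.simps)
  have "ric b v x (Suc n) = wratio b v (Suc n) x"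
    by (rule ric_eq_wratio[where b = b, OF b0]) (rule step.prems)
  then have r: "\<bar>ric b v x (Suc n)\<bar> / b n = \<bar>?p n / ?p (Suc n)\<bar>"
    using b[of n] by (simp add: abs_mult del: opoly.simps ric.simps)
  have "\<bar>?p k / ?p (Suc n)\<bar> = \<bar>?p k / ?p n\<bar> * \<bar>?p n / ?p (Suc n)\<bar>"
    using nz by (simp add: abs_mult del: opoly.simps)
  also have "\<bar>?p k / ?p n\<bar> = (\<Prod>i\<in>{k..<n}. \<bar>ric b v x (Suc i)\<bar> / b i)"
    using step.IH step.prems by simp
  finally show ?case
    using step.hyps by (simp only: r prod.atLeastLessThan_Suc)
qed

text \<open>The eigenvector is cut at \<open>p\<close>. Each side solves a three-term recursion
  started at its end of the box, hence is a multiple of orthogonal polynomials, and the multiples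
  are fixed by the value at \<open>p\<close>. The coefficients that are used come from sites other
  than \<open>p\<close>, so the equation at \<open>p\<close> expresses \<open>\<omega> p\<close>
  through the energy.\<close>

lemma box_eigenvector:
  fixes \<phi> \<omega> :: "int \<Rightarrow> real"
  assumes a: "\<And>n. a n > 0" and order: "lo \<le> p" "p \<le> q" "q \<le> hi"
    and eig: "\<And>m. m \<in> {lo..hi} \<Longrightarrow>
      hop_box lo hi a m * \<phi> (m + 1) + hop_box lo hi a (m - 1) * \<phi> (m - 1) + \<omega> m * \<phi> m = E * \<phi> m"
    and norm: "(\<Sum>m\<in>{lo..hi}. (\<phi> m)\<^sup>2) = 1" and nz: "\<phi> p \<noteq> 0"
    and bL: "\<And>i. bL i = a (lo + int i)" and vL: "\<And>i. i < l \<Longrightarrow> vL i = \<omega> (lo + int i)" and l: "l = nat (p - lo)"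
    and bR: "\<And>i. bR i = a (hi - int i - 1)" and vR: "\<And>i. i < h \<Longrightarrow> vR i = \<omega> (hi - int i)" and h: "h = nat (hi - p)"
  shows "poly (opoly bL vL l) E \<noteq> 0" "poly (opoly bR vR h) E \<noteq> 0"
    "E - wratio bL vL l E - wratio bR vR h E = \<omega> p"
    "(\<phi> p)\<^sup>2 * (1 + wnorm bL vL l E + wnorm bR vR h E) = 1"
    "\<phi> q = \<phi> p * (poly (opoly bR vR (nat (hi - q))) E / poly (opoly bR vR h) E)"
proof -
  let ?L = "\<lambda>i. poly (opoly bL vL i) E" and ?R = "\<lambda>i. poly (opoly bR vR i) E"
  have bL0: "bL i \<noteq> 0" and bR0: "bR i \<noteq> 0" for i using a by (simp_all add: bL bR less_imp_neq[symmetric])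
  have L: "\<phi> (lo + int i) = \<phi> lo * ?L i" if "i \<le> l" for i
  proof -
    have "\<phi> (lo + int i) = \<phi> (lo + int 0) * ?L i"
    proof (rule opoly_unique[where f = "\<lambda>i. \<phi> (lo + int i)" and b = bL and K = l, OF bL0])
      show "bL 0 * \<phi> (lo + int 1) = (E - vL 0) * \<phi> (lo + int 0)" if "1 \<le> l"
      proof -
        have "hop_box lo hi a lo = bL 0" "hop_box lo hi a (lo - 1) = 0" "\<omega> lo = vL 0"
          using that order by (auto simp: hop_box_def bL vL l)
        then show ?thesis using eig[of lo] order unfolding left_diff_distrib by simp
      qed
      show "bL (Suc k) * \<phi> (lo + int (Suc (Suc k))) = (E - vL (Suc k)) * \<phi> (lo + int (Suc k)) - bL k * \<phi> (lo + int k)"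
        if "Suc (Suc k) \<le> l" for k
      proof -
        have m: "lo + int (Suc k) < hi" "lo + int (Suc k) \<in> {lo..hi}" using that order by (auto simp: l)
        then have hop: "hop_box lo hi a (lo + int (Suc k)) = bL (Suc k)" "hop_box lo hi a (lo + int (Suc k) - 1) = bL k"
            "\<omega> (lo + int (Suc k)) = vL (Suc k)"
          using that by (auto simp: hop_box_def bL vL)
        have idx: "lo + int (Suc k) + 1 = lo + int (Suc (Suc k))" "lo + int (Suc k) - 1 = lo + int k" by auto
        from eig[OF m(2), unfolded hop, unfolded idx] show ?thesis unfolding left_diff_distrib by linarith
      qed
    qed (rule that)
    then show ?thesis by simp
  qed
  have R: "\<phi> (hi - int i) = \<phi> hi * ?R i" if "i \<le> h" for i
  proof -
    have "\<phi> (hi - int i) = \<phi> (hi - int 0) * ?R i"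
    proof (rule opoly_unique[where f = "\<lambda>i. \<phi> (hi - int i)" and b = bR and K = h, OF bR0])
      show "bR 0 * \<phi> (hi - int 1) = (E - vR 0) * \<phi> (hi - int 0)" if "1 \<le> h"
      proof -
        have "hop_box lo hi a hi = 0" "hop_box lo hi a (hi - 1) = bR 0" "\<omega> hi = vR 0"
          using that order by (auto simp: hop_box_def bR vR h)
        then show ?thesis using eig[of hi] order unfolding left_diff_distrib by simp
      qed
      show "bR (Suc k) * \<phi> (hi - int (Suc (Suc k))) = (E - vR (Suc k)) * \<phi> (hi - int (Suc k)) - bR k * \<phi> (hi - int k)"
        if "Suc (Suc k) \<le> h" for k
      proof -
        have m: "lo \<le> hi - int (Suc (Suc k))" "hi - int (Suc k) \<in> {lo..hi}" using that order by (auto simp: h)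
        then have hop: "hop_box lo hi a (hi - int (Suc k)) = bR k" "hop_box lo hi a (hi - int (Suc k) - 1) = bR (Suc k)"
            "\<omega> (hi - int (Suc k)) = vR (Suc k)"
          using that by (auto simp: hop_box_def bR vR algebra_simps)
        have idx: "hi - int (Suc k) + 1 = hi - int k" "hi - int (Suc k) - 1 = hi - int (Suc (Suc k))" by auto
        from eig[OF m(2), unfolded hop, unfolded idx] show ?thesis unfolding left_diff_distrib by linarith
      qed
    qed (rule that)
    then show ?thesis by simp
  qed
  have pL: "\<phi> p = \<phi> lo * ?L l" using L[of l] order by (simp add: l)
  have pR: "\<phi> p = \<phi> hi * ?R h" using R[of h] order by (simp add: h)
  show Ll: "?L l \<noteq> 0" using nz pL by auto
  show Rh: "?R h \<noteq> 0" using nz pR by auto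
  have L': "\<phi> (lo + int i) = \<phi> p * (?L i / ?L l)" if "i \<le> l" for i
    using L[OF that] Ll unfolding pL by simp
  have R': "\<phi> (hi - int i) = \<phi> p * (?R i / ?R h)" if "i \<le> h" for i
    using R[OF that] Rh unfolding pR by simp
  have "nat (hi - q) \<le> h" "hi - int (nat (hi - q)) = q" using order by (auto simp: h)
  then show "\<phi> q = \<phi> p * (?R (nat (hi - q)) / ?R h)" using R'[of "nat (hi - q)"] by simp
  have tL: "hop_box lo hi a (p - 1) * \<phi> (p - 1) = \<phi> p * wratio bL vL l E"
  proof (cases l)
    case 0
    then have "p = lo" using order by (simp add: l)
    then show ?thesis using 0 by (simp add: hop_box_def)
  next
    case (Suc k)
    then have p: "p - 1 = lo + int k" using order by (simp add: l)
    have "p - 1 < hi" using order by simp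
    then have "hop_box lo hi a (p - 1) = bL k" unfolding p by (simp add: hop_box_def bL)
    moreover have "\<phi> (p - 1) = \<phi> p * (?L k / ?L (Suc k))" using L'[of k] unfolding p Suc by simp
    ultimately show ?thesis unfolding Suc by (simp del: opoly.simps)
  qed
  have tR: "hop_box lo hi a p * \<phi> (p + 1) = \<phi> p * wratio bR vR h E"
  proof (cases h)
    case 0
    then have "p = hi" using order by (simp add: h)
    then show ?thesis using 0 by (simp add: hop_box_def)
  next
    case (Suc k)
    then have p: "p + 1 = hi - int k" "p < hi" using order by (auto simp: h)
    have "hop_box lo hi a p = a p" using p(2) order by (simp add: hop_box_def)
    moreover have "hi - int k - 1 = p" using p(1) by simp
    ultimately have "hop_box lo hi a p = bR k" by (simp only: bR)
    moreover have "\<phi> (p + 1) = \<phi> p * (?R k / ?R (Suc k))" using R'[of k] unfolding p(1) Suc by simp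
    ultimately show ?thesis unfolding Suc by (simp del: opoly.simps)
  qed
  have "\<phi> p * (wratio bR vR h E + wratio bL vL l E + \<omega> p) = \<phi> p * E"
    using eig[of p] order unfolding tL tR by (simp add: distrib_left mult.commute[of _ "\<phi> p"] add_ac)
  then show "E - wratio bL vL l E - wratio bR vR h E = \<omega> p" using nz by simp
  have split: "{lo..hi} = {lo..p - 1} \<union> ({p} \<union> {p + 1..hi})" using order by auto
  have "1 = (\<Sum>m\<in>{lo..p - 1}. (\<phi> m)\<^sup>2) + ((\<phi> p)\<^sup>2 + (\<Sum>m\<in>{p + 1..hi}. (\<phi> m)\<^sup>2))"
    unfolding norm[symmetric] split by (subst sum.union_disjoint; simp)+
  also have "(\<Sum>m\<in>{lo..p - 1}. (\<phi> m)\<^sup>2) = (\<Sum>i<l. (\<phi> (lo + int i))\<^sup>2)"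
    by (rule sum.reindex_bij_witness[of _ "\<lambda>i. lo + int i" "\<lambda>m. nat (m - lo)"]) (use order in \<open>auto simp: l\<close>)
  also have "(\<Sum>m\<in>{p + 1..hi}. (\<phi> m)\<^sup>2) = (\<Sum>i<h. (\<phi> (hi - int i))\<^sup>2)"
    by (rule sum.reindex_bij_witness[of _ "\<lambda>i. hi - int i" "\<lambda>m. nat (hi - m)"]) (use order in \<open>auto simp: h\<close>)
  also have "(\<Sum>i<l. (\<phi> (lo + int i))\<^sup>2) = (\<phi> p)\<^sup>2 * wnorm bL vL l E"
    unfolding wnorm_def sum_divide_distrib sum_distrib_left
    by (intro sum.cong refl) (simp add: L' power_mult_distrib power_divide del: opoly.simps)
  also have "(\<Sum>i<h. (\<phi> (hi - int i))\<^sup>2) = (\<phi> p)\<^sup>2 * wnorm bR vR h E"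
    unfolding wnorm_def sum_divide_distrib sum_distrib_left
    by (intro sum.cong refl) (simp add: R' power_mult_distrib power_divide del: opoly.simps)
  finally show "(\<phi> p)\<^sup>2 * (1 + wnorm bL vL l E + wnorm bR vR h E) = 1"
    by (simp add: distrib_left add_ac)
qed

section \<open>Spectral averaging\<close>

definition fwd :: "(int \<Rightarrow> real) \<Rightarrow> int \<Rightarrow> nat \<Rightarrow> real" where "fwd f n i = f (n + int i)"

definition bwd :: "(int \<Rightarrow> real) \<Rightarrow> int \<Rightarrow> nat \<Rightarrow> real" where "bwd f n i = f (n - int i)"

lemma borel_measurable_poly_real [measurable]: "poly (p :: real poly) \<in> borel_measurable borel"
  by (intro borel_measurable_continuous_onI continuous_intros)

lemma wratio_measurable [measurable]: "wratio b v n \<in> borel_measurable borel"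
proof (cases n)
  case 0
  have "wratio b v 0 = (\<lambda>_. 0)" by auto
  then show ?thesis using 0 by simp
next
  case (Suc k)
  have "wratio b v (Suc k) = (\<lambda>x. b k * poly (opoly b v k) x / poly (opoly b v (Suc k)) x)"
    by (rule ext) (simp only: wratio.simps)
  also have "\<dots> \<in> borel_measurable borel" by measurable
  finally show ?thesis by (simp only: Suc)
qed

lemma wnorm_measurable [measurable]: "wnorm b v n \<in> borel_measurable borel"
  unfolding wnorm_def by measurable

lemma wnorm_nonneg: "wnorm b v n x \<ge> 0"
  unfolding wnorm_def by (intro divide_nonneg_nonneg sum_nonneg) auto

lemma AE_opoly_neq_0:
  fixes b v :: "nat \<Rightarrow> real"
  assumes b: "\<And>i. b i \<noteq> 0"
  shows "AE x in lborel. \<forall>i\<le>n. poly (opoly b v i) x \<noteq> 0"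
proof (rule AE_I')
  have "finite (\<Union>i\<le>n. {x. poly (opoly b v i) x = 0})"
    by (intro finite_UN_I finite_atMost poly_roots_finite) (rule opoly_neq_0[where b = b, OF b])
  then show "(\<Union>i\<le>n. {x. poly (opoly b v i) x = 0}) \<in> null_sets lborel"
    by (rule finite_imp_null_set_lborel)
qed auto

text \<open>The eigenvalue equation determines the potential \<open>V\<close> at \<open>p\<close> as a function \<open>F\<close> of the eigenvalue
  \<open>x\<close>, and \<open>F' x\<close> is the inverse of \<open>\<bar>\<phi> p\<bar>\<^sup>2\<close> for the normalized eigenvector. The Jacobian of the change of variables
  from \<open>V\<close> to \<open>x\<close> therefore turns \<open>\<bar>\<phi> p * \<phi> q\<bar>\<close> into the ratio \<open>\<bar>\<phi> q / \<phi> p\<bar>\<close>.\<close>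

lemma spectral_averaging:
  fixes a \<omega> :: "int \<Rightarrow> real" and \<rho> :: "real \<Rightarrow> ennreal" and A M :: real
  assumes a: "\<And>n. a n > 0" and A: "\<And>n. \<bar>a n\<bar> \<le> A" and order: "lo \<le> p" "p \<le> q" "q \<le> hi"
    and ij: "i = p \<and> j = q \<or> i = q \<and> j = p"
    and [measurable]: "\<rho> \<in> borel_measurable borel" and supp: "\<And>V. \<rho> V \<noteq> 0 \<Longrightarrow> \<bar>V\<bar> \<le> M"
    and \<omega>: "\<And>n. \<bar>\<omega> n\<bar> \<le> M"
  shows "(\<integral>\<^sup>+V. \<rho> V * (SUP t\<in>T. ennreal (cmod (evol_entry (hop_box lo hi a) (fun_upd \<omega> p V) t i j))) \<partial>lborel)
    \<le> (\<integral>\<^sup>+x. indicator {- (M + 2 * A)..M + 2 * A} x *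
        (\<rho> (x - ric (fwd a lo) (fwd \<omega> lo) x (nat (p - lo)) - ric (bwd a (hi - 1)) (bwd \<omega> hi) x (nat (hi - p)))
          * ennreal (\<Prod>k\<in>{nat (hi - q)..<nat (hi - p)}. \<bar>ric (bwd a (hi - 1)) (bwd \<omega> hi) x (Suc k)\<bar> / bwd a (hi - 1) k)) \<partial>lborel)"
proof -
  define bL where "bL = fwd a lo"
  define vL where "vL = fwd \<omega> lo"
  define l where "l = nat (p - lo)"
  define bR where "bR = bwd a (hi - 1)"
  define vR where "vR = bwd \<omega> hi"
  define h where "h = nat (hi - p)"
  note defs = bL_def vL_def l_def bR_def vR_def h_def
  have bL: "bL i > 0" and bR: "bR i > 0" for i using a by (simp_all add: defs fwd_def bwd_def)
  then have bL0: "bL i \<noteq> 0" and bR0: "bR i \<noteq> 0" for i by (simp_all add: less_imp_neq[symmetric])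
  define F where "F x = x - wratio bL vL l x - wratio bR vR h x" for x
  define F' where "F' x = 1 + wnorm bL vL l x + wnorm bR vR h x" for x
  define W where "W x = \<bar>poly (opoly bR vR (nat (hi - q))) x / poly (opoly bR vR h) x\<bar>" for x
  \<comment> \<open>Off the zeros of the two denominators \<open>F\<close> is differentiable with
    derivative \<open>F'\<close>; this open set is the domain for the area formula.\<close>
  define G where "G = {x. poly (opoly bL vL l) x \<noteq> 0 \<and> poly (opoly bR vR h) x \<noteq> 0}"
  define I where "I = {- (M + 2 * A)..M + 2 * A}"
  define H where "H x = indicator I x * (\<rho> (F x) * ennreal (W x))" for x
  have [measurable]: "F \<in> borel_measurable borel" "F' \<in> borel_measurable borel" "W \<in> borel_measurable borel" "I \<in> sets borel"
    unfolding F_def F'_def W_def I_def by measurable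
  have [measurable]: "H \<in> borel_measurable borel" unfolding H_def by measurable
  have F'_pos: "F' x > 0" for x
    unfolding F'_def using wnorm_nonneg[of bL vL l x] wnorm_nonneg[of bR vR h x] by linarith
  have W_nonneg: "W x \<ge> 0" for x by (simp only: W_def abs_ge_zero)
  \<comment> \<open>For each \<open>V\<close> a finite set of eigenvalues is chosen, with no
    measurable dependence on \<open>V\<close>; \<open>area_formula_le\<close> accepts such a
    choice.\<close>
  have ex: "\<exists>X. finite X \<and> X \<subseteq> G \<and> (\<forall>x\<in>X. F x = V) \<and>
      \<rho> V * (SUP t\<in>T. ennreal (cmod (evol_entry (hop_box lo hi a) (fun_upd \<omega> p V) t i j))) \<le> (\<Sum>x\<in>X. H x / ennreal (F' x))"
    for V
  proof (cases "\<rho> V = 0")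
    case True
    then show ?thesis by (intro exI[of _ "{}"]) simp
  next
    case False
    then have V: "\<bar>V\<bar> \<le> M" by (rule supp)
    have "lo \<le> hi" using order by simp
    from jacobi_box_spectral_resolution[where a = a and \<omega> = "fun_upd \<omega> p V", OF a this] obtain S :: "real set" and \<phi> where
      S: "finite S"
      and eig: "\<forall>E\<in>S. \<forall>m\<in>{lo..hi}. hop_box lo hi a m * \<phi> E (m + 1)
          + hop_box lo hi a (m - 1) * \<phi> E (m - 1) + (fun_upd \<omega> p V) m * \<phi> E m = E * \<phi> E m"
      and norm: "\<forall>E\<in>S. (\<Sum>m\<in>{lo..hi}. (\<phi> E m)\<^sup>2) = 1"
      and pow: "\<forall>k. \<forall>m\<in>{lo..hi}. \<forall>n\<in>{lo..hi}.
          jac_pow (hop_box lo hi a) (fun_upd \<omega> p V) k m n = (\<Sum>E\<in>S. E ^ k * (\<phi> E m * \<phi> E n))"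
      by (elim exE conjE) (rule that)
    note eig = eig[rule_format] and norm = norm[rule_format] and pow = pow[rule_format]
    \<comment> \<open>An eigenvector vanishing at \<open>p\<close> contributes nothing to the sum of
      \<open>\<bar>\<phi> p * \<phi> q\<bar>\<close>, while the description of the energy by
      \<open>F\<close> requires a nonzero value there.\<close>
    define X where "X = {E \<in> S. \<phi> E p \<noteq> 0}"
    have key: "E \<in> G" "F E = V" "\<bar>\<phi> E p * \<phi> E q\<bar> = W E / F' E" "E \<in> I" if E: "E \<in> X" for E
    proof -
      have ES: "E \<in> S" and nz: "\<phi> E p \<noteq> 0" using E by (auto simp: X_def)
      have vL: "vL i = (fun_upd \<omega> p V) (lo + int i)" if "i < l" for i using that by (auto simp: defs fwd_def)
      have vR: "vR i = (fun_upd \<omega> p V) (hi - int i)" if "i < h" for i using that by (auto simp: defs bwd_def)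
      have bLeq: "bL i = a (lo + int i)" and bReq: "bR i = a (hi - int i - 1)" for i
        by (simp_all add: defs fwd_def bwd_def algebra_simps)
      note ev = box_eigenvector[where a = a and \<phi> = "\<phi> E" and \<omega> = "fun_upd \<omega> p V" and bL = bL and bR = bR and vL = vL and vR = vR,
          OF a order eig[OF ES] norm[OF ES] nz bLeq vL defs(3) bReq vR defs(6)]
      show "E \<in> G" using ev(1,2) by (simp only: G_def mem_Collect_eq simp_thms)
      show "F E = V" using ev(3) by (simp only: F_def fun_upd_same)
      have "(\<phi> E p)\<^sup>2 = 1 / F' E"
        using ev(4) F'_pos[of E] unfolding F'_def[symmetric] by (simp add: field_simps)
      moreover have "\<bar>\<phi> E p * \<phi> E q\<bar> = (\<phi> E p)\<^sup>2 * W E"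
      proof -
        have "\<bar>\<phi> E q\<bar> = \<bar>\<phi> E p\<bar> * W E" unfolding W_def abs_mult[symmetric] by (rule arg_cong[OF ev(5)])
        then show ?thesis by (simp add: abs_mult power2_eq_square)
      qed
      ultimately show "\<bar>\<phi> E p * \<phi> E q\<bar> = W E / F' E" by simp
      have "\<bar>(fun_upd \<omega> p V) n\<bar> \<le> M" for n using \<omega>[of n] V by simp
      then have "\<bar>E\<bar> \<le> M + 2 * A"
        using order by (intro jacobi_box_eigenvalue_le[where \<phi> = "\<phi> E" and a = a and k = p, OF eig[OF ES] _ nz A]) auto
      then show "E \<in> I" by (auto simp: I_def)
    qed
    have ij': "i \<in> {lo..hi}" "j \<in> {lo..hi}" using ij order by auto
    have "cmod (evol_entry (hop_box lo hi a) (fun_upd \<omega> p V) t i j) \<le> (\<Sum>E\<in>X. W E / F' E)" for t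
    proof -
      have "cmod (evol_entry (hop_box lo hi a) (fun_upd \<omega> p V) t i j) \<le> (\<Sum>E\<in>S. \<bar>\<phi> E i * \<phi> E j\<bar>)"
        by (rule norm_evol_entry_le[OF S pow[OF ij']])
      also have "\<dots> = (\<Sum>E\<in>S. \<bar>\<phi> E p * \<phi> E q\<bar>)" using ij by (auto simp: mult.commute)
      also have "\<dots> = (\<Sum>E\<in>X. \<bar>\<phi> E p * \<phi> E q\<bar>)"
        using S by (intro sum.mono_neutral_right) (auto simp: X_def)
      also have "\<dots> = (\<Sum>E\<in>X. W E / F' E)" by (intro sum.cong refl key(3))
      finally show ?thesis .
    qed
    then have "(SUP t\<in>T. ennreal (cmod (evol_entry (hop_box lo hi a) (fun_upd \<omega> p V) t i j))) \<le> ennreal (\<Sum>E\<in>X. W E / F' E)"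
      by (intro SUP_least ennreal_leI)
    then have "\<rho> V * (SUP t\<in>T. ennreal (cmod (evol_entry (hop_box lo hi a) (fun_upd \<omega> p V) t i j)))
        \<le> \<rho> V * ennreal (\<Sum>E\<in>X. W E / F' E)"
      by (rule mult_left_mono) simp
    also have "ennreal (\<Sum>E\<in>X. W E / F' E) = (\<Sum>E\<in>X. ennreal (W E / F' E))"
      by (rule sum_ennreal[symmetric]) (rule divide_nonneg_pos[OF W_nonneg F'_pos])
    also have "\<rho> V * \<dots> = (\<Sum>E\<in>X. \<rho> V * ennreal (W E / F' E))" by (rule sum_distrib_left)
    also have "\<dots> = (\<Sum>E\<in>X. H E / ennreal (F' E))"
    proof (intro sum.cong refl)
      fix E assume E: "E \<in> X"
      have "ennreal (W E / F' E) = ennreal (W E) / ennreal (F' E)"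
        by (rule divide_ennreal[symmetric]) (auto simp: W_nonneg F'_pos)
      then show "\<rho> V * ennreal (W E / F' E) = H E / ennreal (F' E)"
        using key(2,4)[OF E] by (simp add: H_def ennreal_times_divide)
    qed
    finally have "\<rho> V * (SUP t\<in>T. ennreal (cmod (evol_entry (hop_box lo hi a) (fun_upd \<omega> p V) t i j)))
        \<le> (\<Sum>E\<in>X. H E / ennreal (F' E))" .
    moreover have "finite X" using S by (simp add: X_def)
    ultimately show ?thesis using key(1,2) by (intro exI[of _ X]) blast
  qed
  then obtain X where X: "\<And>V. finite (X V)" "\<And>V. X V \<subseteq> G" "\<And>V x. x \<in> X V \<Longrightarrow> F x = V"
    "\<And>V. \<rho> V * (SUP t\<in>T. ennreal (cmod (evol_entry (hop_box lo hi a) (fun_upd \<omega> p V) t i j))) \<le> (\<Sum>x\<in>X V. H x / ennreal (F' x))"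
    by metis
  have "(\<integral>\<^sup>+V. \<rho> V * (SUP t\<in>T. ennreal (cmod (evol_entry (hop_box lo hi a) (fun_upd \<omega> p V) t i j))) \<partial>lborel)
      \<le> (\<integral>\<^sup>+V. (\<Sum>x\<in>X V. H x / ennreal (F' x)) \<partial>lborel)"
    by (intro nn_integral_mono X(4))
  also have "\<dots> \<le> (\<integral>\<^sup>+x. H x * indicator G x \<partial>lborel)"
  proof (rule area_formula_le)
    show "open G"
      unfolding G_def by (intro open_Collect_conj open_Collect_neq continuous_intros)
    show "(F has_real_derivative F' x) (at x)" if "x \<in> G" for x
    proof -
      have nz: "poly (opoly bL vL l) x \<noteq> 0" "poly (opoly bR vR h) x \<noteq> 0" using that by (simp_all only: G_def mem_Collect_eq simp_thms)
      have "((\<lambda>x. x - wratio bL vL l x - wratio bR vR h x) has_real_derivative 1 - (- wnorm bL vL l x) - (- wnorm bR vR h x)) (at x)"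
        by (intro DERIV_diff DERIV_ident wratio_deriv[where b = bL, OF bL0 nz(1)] wratio_deriv[where b = bR, OF bR0 nz(2)])
      then show ?thesis by (simp add: F_def[abs_def] F'_def)
    qed
    show "continuous_on G F'"
      unfolding F'_def wnorm_def by (intro continuous_intros) (auto simp: G_def simp del: opoly.simps)
  qed (use X in \<open>auto intro: F'_pos\<close>)
  also have "\<dots> \<le> (\<integral>\<^sup>+x. H x \<partial>lborel)"
    by (intro nn_integral_mono) (auto simp: indicator_def)
  also have "\<dots> = (\<integral>\<^sup>+x. indicator I x * (\<rho> (x - ric bL vL x l - ric bR vR x h)
      * ennreal (\<Prod>k\<in>{nat (hi - q)..<h}. \<bar>ric bR vR x (Suc k)\<bar> / bR k)) \<partial>lborel)"
  proof (rule nn_integral_cong_AE)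
    show "AE x in lborel. H x = indicator I x * (\<rho> (x - ric bL vL x l - ric bR vR x h)
      * ennreal (\<Prod>k\<in>{nat (hi - q)..<h}. \<bar>ric bR vR x (Suc k)\<bar> / bR k))"
      using AE_opoly_neq_0[where b = bL and v = vL and n = l, OF bL0] AE_opoly_neq_0[where b = bR and v = vR and n = h, OF bR0]
    proof eventually_elim
      case (elim x)
      have "ric bL vL x l = wratio bL vL l x"
        by (rule ric_eq_wratio[where b = bL, OF bL0]) (use elim(1) in blast)
      moreover have "ric bR vR x h = wratio bR vR h x"
        by (rule ric_eq_wratio[where b = bR, OF bR0]) (use elim(2) in blast)
      moreover have "W x = (\<Prod>k\<in>{nat (hi - q)..<h}. \<bar>ric bR vR x (Suc k)\<bar> / bR k)"
        unfolding W_def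
        by (rule poly_ratio_eq_prod_ric[where b = bR, OF bR]) (use elim(2) order in \<open>auto simp: defs(6)\<close>)
      ultimately show ?case by (simp only: H_def F_def)
    qed
  qed
  finally show ?thesis unfolding defs I_def .
qed

section \<open>Transfer operators\<close>

lemma ennreal_le_of_power2_le:
  assumes "x\<^sup>2 \<le> (ennreal y)\<^sup>2" "0 \<le> y"
  shows "x \<le> ennreal y"
proof (cases x)
  case (real r)
  then have "ennreal (r\<^sup>2) \<le> ennreal (y\<^sup>2)" using assms by (simp add: ennreal_power)
  then have "r\<^sup>2 \<le> y\<^sup>2" by (subst (asm) ennreal_le_iff) auto
  then have "r \<le> y" using assms(2) by (rule power2_le_imp_le)
  then show ?thesis using real by (simp add: ennreal_leI)
next
  case top
  then show ?thesis using assms by (simp add: ennreal_power top_unique)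
qed

context bounded_density
begin

text \<open>The index \<open>j\<close> counts the sites integrated out, and \<open>z\<close> is the
  Riccati variable of the remaining outer sites. The start is the density at \<open>p\<close> as a
  function of \<open>z\<close>; the shift \<open>s\<close> collects the energy, the background at
  \<open>p\<close> and the Riccati variable from the left.\<close>

fun transfer :: "(nat \<Rightarrow> real) \<Rightarrow> (nat \<Rightarrow> real) \<Rightarrow> real \<Rightarrow> nat \<Rightarrow> real \<Rightarrow> ennreal" where
  "transfer e b s 0 z = \<rho> (s - z)"
| "transfer e b s (Suc j) z = conv (e j) (inversion (b j) (transfer e b s j)) z"

lemma transfer_measurable [measurable]:
  assumes [measurable]: "f \<in> borel_measurable N" "g \<in> borel_measurable N"
  shows "(\<lambda>w. transfer e b (f w) j (g w)) \<in> borel_measurable N"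
proof -
  have "(\<lambda>(s, z). transfer e b s j z) \<in> borel_measurable (borel \<Otimes>\<^sub>M borel)"
  proof (induction j)
    case (Suc j)
    note [measurable] = Suc
    have "(\<lambda>((s, z), y). transfer e b s j ((b j)\<^sup>2 / y)) \<in> borel_measurable ((borel \<Otimes>\<^sub>M borel) \<Otimes>\<^sub>M lborel)"
      using measurable_compose[of "\<lambda>((s, z :: real), y). (s, (b j)\<^sup>2 / y)" "(borel \<Otimes>\<^sub>M borel) \<Otimes>\<^sub>M lborel" "borel \<Otimes>\<^sub>M borel"
          "\<lambda>(s, z). transfer e b s j z" borel, OF _ Suc] by (simp add: split_beta')
    then have [measurable]: "(\<lambda>w. transfer e b (fst (fst w)) j ((b j)\<^sup>2 / snd w)) \<in> borel_measurable ((borel \<Otimes>\<^sub>M borel) \<Otimes>\<^sub>M lborel)"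
      by (simp add: split_beta')
    have "(\<lambda>u. \<integral>\<^sup>+y. \<rho> (e j - snd u - y) * (ennreal (b j / \<bar>y\<bar>) * transfer e b (fst u) j ((b j)\<^sup>2 / y)) \<partial>lborel)
        \<in> borel_measurable (borel \<Otimes>\<^sub>M borel)"
      by (rule lborel.borel_measurable_nn_integral) (simp add: split_beta', measurable)
    then show ?case by (simp add: split_beta' conv_def inversion_def)
  qed (simp add: split_beta')
  from measurable_compose[OF measurable_Pair[OF assms] this] show ?thesis by simp
qed

lemma sqnorm_density_le: "sqnorm (\<lambda>z. \<rho> (s - z)) \<le> ennreal B"
proof -
  have "sqnorm (\<lambda>z. \<rho> (s - z)) \<le> (\<integral>\<^sup>+z. ennreal B * \<rho> (s - z) \<partial>lborel)"
    unfolding sqnorm_def power2_eq_square by (intro nn_integral_mono mult_right_mono density_le) simp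
  also have "\<dots> = ennreal B * (\<integral>\<^sup>+z. \<rho> (s - z) \<partial>lborel)" by (rule nn_integral_cmult) measurable
  also have "(\<integral>\<^sup>+z. \<rho> (s - z) \<partial>lborel) = 1"
    by (subst nn_integral_lborel_reflect) (simp_all add: density_total)
  finally show ?thesis by simp
qed

text \<open>The last convolution is spent on the bound by \<open>conv_sq_le\<close>, and the
  remaining \<open>j - 1\<close> steps contract in pairs. The root appears because the contraction
  concerns squared norms. For \<open>j = 0\<close> truncated subtraction makes the exponent 0 and
  the bound \<open>B\<close>.\<close>

lemma transfer_decay:
  assumes "A > 0"
  obtains \<kappa> :: real where "0 < \<kappa>" "\<kappa> < 1"
    "\<And>e b s j z. \<forall>i. 0 < b i \<and> b i \<le> A \<Longrightarrow> transfer e b s j z \<le> ennreal (B * \<kappa> ^ ((j - 1) div 2))"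
proof -
  obtain \<kappa> where \<kappa>: "0 < \<kappa>" "\<kappa> < 1" "\<And>g b e e'. g \<in> borel_measurable borel \<Longrightarrow> 0 < b \<Longrightarrow> b \<le> A \<Longrightarrow>
      sqnorm (conv e (inversion b (conv e' g))) \<le> ennreal \<kappa> * sqnorm g"
    by (rule conv_inversion_conv_contraction[OF assms]) (rule that)
  show thesis
  proof (rule that[of "sqrt \<kappa>"])
    show "0 < sqrt \<kappa>" "sqrt \<kappa> < 1" using \<kappa> by auto
    fix e b :: "nat \<Rightarrow> real" and s :: real and j :: nat and z :: real
    assume "\<forall>i. 0 < b i \<and> b i \<le> A"
    then have b: "0 < b i" "b i \<le> A" for i by blast+
    have [measurable]: "transfer e b s i \<in> borel_measurable borel" for i by measurable
    have step: "transfer e b s (Suc i) = conv (e i) (inversion (b i) (transfer e b s i))" for i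
      by (rule ext) simp
    have sq: "sqnorm (transfer e b s i) \<le> ennreal (B * \<kappa> ^ (i div 2))" for i
    proof (induction i rule: induct_nat_012)
      case 0
      have "transfer e b s 0 = (\<lambda>z. \<rho> (s - z))" by (rule ext) simp
      then show ?case using sqnorm_density_le by simp
    next
      case 1
      have "sqnorm (transfer e b s (Suc 0)) \<le> sqnorm (inversion (b 0) (transfer e b s 0))"
        unfolding step by (rule sqnorm_conv_le) measurable
      also have "\<dots> \<le> sqnorm (transfer e b s 0)" by (rule sqnorm_inversion_le[OF b(1)]) measurable
      also have "transfer e b s 0 = (\<lambda>z. \<rho> (s - z))" by (rule ext) simp
      also have "sqnorm \<dots> \<le> ennreal B" by (rule sqnorm_density_le)
      finally show ?case by simp
    next
      case (ge2 i)
      \<comment> \<open>Two steps alternate convolution and inversion, so the contraction applies to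
        the function obtained after the innermost inversion.\<close>
      have "sqnorm (transfer e b s (Suc (Suc i))) \<le> ennreal \<kappa> * sqnorm (inversion (b i) (transfer e b s i))"
        unfolding step by (rule \<kappa>(3)) (auto simp: b)
      also have "\<dots> \<le> ennreal \<kappa> * sqnorm (transfer e b s i)"
        by (intro mult_left_mono sqnorm_inversion_le[OF b(1)]) auto
      also have "\<dots> \<le> ennreal \<kappa> * ennreal (B * \<kappa> ^ (i div 2))" by (intro mult_left_mono ge2) auto
      also have "\<dots> = ennreal (B * \<kappa> ^ (Suc (Suc i) div 2))"
        using \<kappa> B_pos by (simp add: ac_simps flip: ennreal_mult)
      finally show ?case .
    qed
    show "transfer e b s j z \<le> ennreal (B * sqrt \<kappa> ^ ((j - 1) div 2))"
    proof (cases j)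
      case 0
      then show ?thesis using density_le by simp
    next
      case (Suc i)
      have "(transfer e b s j z)\<^sup>2 \<le> ennreal B * sqnorm (inversion (b i) (transfer e b s i))"
        unfolding Suc step by (rule conv_sq_le) measurable
      also have "\<dots> \<le> ennreal B * ennreal (B * \<kappa> ^ (i div 2))"
        by (intro mult_left_mono order_trans[OF sqnorm_inversion_le[OF b(1)] sq]) auto
      also have "\<dots> = ennreal ((B * sqrt \<kappa> ^ (i div 2))\<^sup>2)"
        using \<kappa> B_pos by (simp add: power2_eq_square flip: ennreal_mult) (simp add: ac_simps flip: power_mult_distrib)
      also have "\<dots> = (ennreal (B * sqrt \<kappa> ^ (i div 2)))\<^sup>2"
        using \<kappa> B_pos by (simp add: ennreal_power)
      finally show ?thesis unfolding Suc using \<kappa> B_pos by (intro ennreal_le_of_power2_le) simp_all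
    qed
  qed
qed

end

lemma ric_measurable:
  assumes "\<And>i. (\<lambda>w. v w i) \<in> borel_measurable N" and [measurable]: "x \<in> borel_measurable N"
  shows "(\<lambda>w. ric b (v w) (x w) k) \<in> borel_measurable N"
proof (induction k)
  case (Suc k)
  note [measurable] = Suc assms(1)
  show ?case by simp
qed simp

lemma ric_cong:
  "(\<And>i. i < k \<Longrightarrow> v i = v' i) \<Longrightarrow> ric b v x k = ric b v' x k"
  by (induction k) auto

text \<open>Overwriting one coordinate by an independent sample with the same law preserves a
  product measure. This isolates one potential without splitting the index set.\<close>

lemma nn_integral_PiM_resample:
  fixes M :: "'i \<Rightarrow> 'a measure"
  assumes M: "\<And>i. prob_space (M i)" and [measurable]: "f \<in> borel_measurable (PiM UNIV M)"
  shows "(\<integral>\<^sup>+\<omega>. f \<omega> \<partial>PiM UNIV M) = (\<integral>\<^sup>+\<omega>. \<integral>\<^sup>+V. f (fun_upd \<omega> i V) \<partial>M i \<partial>PiM UNIV M)"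
proof -
  interpret Mi: prob_space "M i" by (rule M)
  interpret P: prob_space "PiM UNIV M" by (rule prob_space_PiM) (rule M)
  interpret pair_sigma_finite "M i" "PiM UNIV M" ..
  have [measurable]: "(\<lambda>(x, X). fun_upd X i x) \<in> M i \<Otimes>\<^sub>M PiM UNIV M \<rightarrow>\<^sub>M PiM UNIV M"
    using measurable_fun_upd[of UNIV UNIV i "snd" "M i \<Otimes>\<^sub>M PiM UNIV M" M fst] by (simp add: split_beta')
  have "PiM UNIV M = distr (M i \<Otimes>\<^sub>M PiM UNIV M) (PiM UNIV M) (\<lambda>(x, X). fun_upd X i x)"
    using distr_pair_PiM_eq_PiM[of UNIV M i] M by simp
  then have "(\<integral>\<^sup>+\<omega>. f \<omega> \<partial>PiM UNIV M) = (\<integral>\<^sup>+\<omega>. f \<omega> \<partial>distr (M i \<Otimes>\<^sub>M PiM UNIV M) (PiM UNIV M) (\<lambda>(x, X). fun_upd X i x))"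
    by simp
  also have "\<dots> = (\<integral>\<^sup>+w. f (fun_upd (snd w) i (fst w)) \<partial>(M i \<Otimes>\<^sub>M PiM UNIV M))"
    by (subst nn_integral_distr) (simp_all add: split_beta')
  also have "\<dots> = (\<integral>\<^sup>+\<omega>. \<integral>\<^sup>+V. f (fun_upd \<omega> i V) \<partial>M i \<partial>PiM UNIV M)"
  proof -
    have "(\<lambda>w. f (fun_upd (snd w) i (fst w))) \<in> borel_measurable (M i \<Otimes>\<^sub>M PiM UNIV M)"
      using measurable_compose[OF \<open>(\<lambda>(x, X). fun_upd X i x) \<in> _\<close> assms(2)] by (simp add: split_beta')
    from nn_integral_snd[OF this] show ?thesis by simp
  qed
  finally show ?thesis .
qed

section \<open>Integrating out the potential\<close>

context bounded_density
begin

definition site :: "(int \<Rightarrow> real) \<Rightarrow> int \<Rightarrow> real measure" where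
  "site c n = density lborel (\<lambda>V. \<rho> (V - c n))"

lemma sets_site [simp, measurable_cong]: "sets (site c n) = sets borel"
  by (simp add: site_def)

lemma nn_integral_site:
  "f \<in> borel_measurable borel \<Longrightarrow> (\<integral>\<^sup>+V. f V \<partial>site c n) = (\<integral>\<^sup>+V. \<rho> (V - c n) * f V \<partial>lborel)"
  unfolding site_def by (rule nn_integral_density) auto

lemma prob_space_site: "prob_space (site c n)"
proof (rule prob_spaceI)
  have "emeasure (site c n) (space (site c n)) = (\<integral>\<^sup>+V. \<rho> (V + - c n) \<partial>lborel)"
    by (simp add: site_def emeasure_density)
  also have "\<dots> = 1" by (subst nn_integral_lborel_shift) (simp_all add: density_total)
  finally show "emeasure (site c n) (space (site c n)) = 1" .
qed

lemma fwd_bwd_measurable: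
  "(\<lambda>\<omega>. fwd \<omega> n i) \<in> borel_measurable (PiM UNIV (site c))"
  "(\<lambda>\<omega>. bwd \<omega> n i) \<in> borel_measurable (PiM UNIV (site c))"
proof -
  have "(\<lambda>\<omega>. \<omega> k) \<in> borel_measurable (PiM UNIV (site c))" for k
    using measurable_component_singleton[of k UNIV "site c"] by simp
  then show "(\<lambda>\<omega>. fwd \<omega> n i) \<in> borel_measurable (PiM UNIV (site c))"
    "(\<lambda>\<omega>. bwd \<omega> n i) \<in> borel_measurable (PiM UNIV (site c))" by (simp_all add: fwd_def bwd_def)
qed

text \<open>Given the Riccati variable \<open>z\<close> of the outer sites, integrating over the potential \<open>V\<close> at the next site
  and substituting \<open>y = x - V - z\<close> applies one transfer operator. Sites are integrated out from \<open>p + 1\<close> to \<open>q\<close>.\<close>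

lemma nn_integral_weighted_product_le:
  fixes a c :: "int \<Rightarrow> real" and x :: real
  assumes a: "\<And>n. 0 < a n" "\<And>n. a n \<le> A" and order: "p \<le> q" "q \<le> hi"
    and decay: "\<And>e b s j z. \<forall>i. 0 < b i \<and> b i \<le> A \<Longrightarrow> transfer e b s j z \<le> ennreal (C j)"
  shows "(\<integral>\<^sup>+\<omega>. \<rho> (x - ric (fwd a lo) (fwd \<omega> lo) x (nat (p - lo)) - ric (bwd a (hi - 1)) (bwd \<omega> hi) x (nat (hi - p)) - c p)
      * ennreal (\<Prod>k\<in>{nat (hi - q)..<nat (hi - p)}. \<bar>ric (bwd a (hi - 1)) (bwd \<omega> hi) x (Suc k)\<bar> / bwd a (hi - 1) k)
      \<partial>PiM UNIV (site c)) \<le> ennreal (C (nat (q - p)))"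
proof -
  interpret P: prob_space "PiM UNIV (site c)" by (rule prob_space_PiM) (rule prob_space_site)
  define h where "h = nat (hi - p)"
  define K where "K = nat (hi - q)"
  define n where "n = nat (q - p)"
  have h: "h = K + n" using order by (simp add: h_def K_def n_def)
  define b where "b = bwd a (hi - 1)"
  define R where "R \<omega> k = ric b (bwd \<omega> hi) x k" for \<omega> k
  define s where "s \<omega> = x - c p - ric (fwd a lo) (fwd \<omega> lo) x (nat (p - lo))" for \<omega>
  \<comment> \<open>Step \<open>j\<close> integrates out the potential at \<open>p + 1 + j\<close>;
    \<open>bb j\<close> is the hopping between that site and \<open>p + j\<close>.\<close>
  define e where "e j = x - c (p + 1 + int j)" for j
  define bb where "bb j = a (p + int j)" for j
  \<comment> \<open>The integrand after \<open>j\<close> steps. The variable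
    \<open>R \<omega> (h - j)\<close> depends only on sites beyond \<open>p + j\<close>, and the
    product has lost its last \<open>j\<close> factors.\<close>
  define f where "f j \<omega> = transfer e bb (s \<omega>) j (R \<omega> (h - j)) * ennreal (\<Prod>k\<in>{K..<h - j}. \<bar>R \<omega> (Suc k)\<bar> / b k)" for j \<omega>
  have b: "0 < b k" for k by (simp add: b_def bwd_def a)
  have R_meas [measurable]: "(\<lambda>\<omega>. R \<omega> k) \<in> borel_measurable (PiM UNIV (site c))" for k
    unfolding R_def by (intro ric_measurable fwd_bwd_measurable) simp
  have s_meas [measurable]: "s \<in> borel_measurable (PiM UNIV (site c))"
  proof -
    have [measurable]: "(\<lambda>\<omega>. ric (fwd a lo) (fwd \<omega> lo) x (nat (p - lo))) \<in> borel_measurable (PiM UNIV (site c))"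
      by (intro ric_measurable fwd_bwd_measurable) simp
    show ?thesis unfolding s_def by measurable
  qed
  have f_meas: "f j \<in> borel_measurable (PiM UNIV (site c))" for j
    unfolding f_def by measurable
  have step: "(\<integral>\<^sup>+\<omega>. f j \<omega> \<partial>PiM UNIV (site c)) = (\<integral>\<^sup>+\<omega>. f (Suc j) \<omega> \<partial>PiM UNIV (site c))" if j: "j < n" for j
  proof -
    define m where "m = p + 1 + int j"
    define k where "k = h - Suc j"
    have hj: "h - j = Suc k" and Kk: "K \<le> k" and km: "hi - int k = m"
      using j order by (auto simp: k_def h m_def K_def n_def)
    have bk: "b k = bb j" using km by (simp add: b_def bwd_def bb_def m_def algebra_simps)
    \<comment> \<open>The potential at \<open>m\<close> enters only through
      \<open>R (Suc k)\<close>, which occurs in the argument of \<open>transfer\<close> and in the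
      last factor of the product. That factor supplies the weight of \<open>inversion\<close>, so
      one step is an identity.\<close>
    have "(\<integral>\<^sup>+V. f j (fun_upd \<omega> m V) \<partial>site c m) = f (Suc j) \<omega>" for \<omega>
    proof -
      define z where "z = R \<omega> k"
      define w where "w = ennreal (\<Prod>i\<in>{K..<k}. \<bar>R \<omega> (Suc i)\<bar> / b i)"
      define T where "T = transfer e bb (s \<omega>) j"
      have [measurable]: "T \<in> borel_measurable borel" unfolding T_def by measurable
      have R_upd: "R (fun_upd \<omega> m V) i = R \<omega> i" if "i \<le> k" for i V
        unfolding R_def by (rule ric_cong) (use that km in \<open>auto simp: bwd_def\<close>)
      have s_upd: "s (fun_upd \<omega> m V) = s \<omega>" for V
      proof -
        have "ric (fwd a lo) (fwd (fun_upd \<omega> m V) lo) x (nat (p - lo)) = ric (fwd a lo) (fwd \<omega> lo) x (nat (p - lo))"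
          by (rule ric_cong) (auto simp: fwd_def m_def)
        then show ?thesis by (simp add: s_def)
      qed
      have R_last: "R (fun_upd \<omega> m V) (Suc k) = (b k)\<^sup>2 / (x - V - z)" for V
      proof -
        have "R (fun_upd \<omega> m V) (Suc k) = (b k)\<^sup>2 / (x - bwd (fun_upd \<omega> m V) hi k - R (fun_upd \<omega> m V) k)"
          by (simp add: R_def)
        also have "bwd (fun_upd \<omega> m V) hi k = V" by (simp add: bwd_def km)
        also have "R (fun_upd \<omega> m V) k = z" unfolding z_def by (rule R_upd) simp
        finally show ?thesis .
      qed
      define g where "g y = \<rho> (e j - z - y) * (T ((bb j)\<^sup>2 / y) * (w * ennreal (bb j / \<bar>y\<bar>)))" for y
      have [measurable]: "g \<in> borel_measurable borel" unfolding g_def by measurable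
      have f_upd: "f j (fun_upd \<omega> m V) = T ((bb j)\<^sup>2 / (x - V - z)) * (w * ennreal (bb j / \<bar>x - V - z\<bar>))" for V
      proof -
        have "(\<Prod>i\<in>{K..<Suc k}. \<bar>R (fun_upd \<omega> m V) (Suc i)\<bar> / b i)
            = (\<Prod>i\<in>{K..<k}. \<bar>R (fun_upd \<omega> m V) (Suc i)\<bar> / b i) * (\<bar>R (fun_upd \<omega> m V) (Suc k)\<bar> / b k)"
          by (rule prod.atLeastLessThan_Suc[OF Kk])
        also have "(\<Prod>i\<in>{K..<k}. \<bar>R (fun_upd \<omega> m V) (Suc i)\<bar> / b i) = (\<Prod>i\<in>{K..<k}. \<bar>R \<omega> (Suc i)\<bar> / b i)"
          by (intro prod.cong refl) (simp add: R_upd)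
        also have "\<bar>R (fun_upd \<omega> m V) (Suc k)\<bar> / b k = bb j / \<bar>x - V - z\<bar>"
          unfolding R_last using b[of k] by (simp add: bk[symmetric] abs_divide power2_eq_square)
        finally have eq: "(\<Prod>i\<in>{K..<Suc k}. \<bar>R (fun_upd \<omega> m V) (Suc i)\<bar> / b i)
            = (\<Prod>i\<in>{K..<k}. \<bar>R \<omega> (Suc i)\<bar> / b i) * (bb j / \<bar>x - V - z\<bar>)" .
        have "ennreal (\<Prod>i\<in>{K..<Suc k}. \<bar>R (fun_upd \<omega> m V) (Suc i)\<bar> / b i) = w * ennreal (bb j / \<bar>x - V - z\<bar>)"
          unfolding eq w_def by (intro ennreal_mult' prod_nonneg) (simp add: less_imp_le[OF b])
        then show ?thesis unfolding f_def hj T_def s_upd R_last bk by (simp only:)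
      qed
      have "(\<integral>\<^sup>+V. f j (fun_upd \<omega> m V) \<partial>site c m) = (\<integral>\<^sup>+V. \<rho> (V - c m) * f j (fun_upd \<omega> m V) \<partial>lborel)"
        unfolding f_upd by (rule nn_integral_site) measurable
      also have "\<dots> = (\<integral>\<^sup>+V. g ((x - z) - V) \<partial>lborel)"
      proof (intro nn_integral_cong)
        fix V
        have "e j - z - (x - z - V) = V - c m" "x - z - V = x - V - z" by (simp_all add: e_def m_def)
        then show "\<rho> (V - c m) * f j (fun_upd \<omega> m V) = g (x - z - V)"
          by (simp only: f_upd g_def)
      qed
      also have "\<dots> = (\<integral>\<^sup>+y. g y \<partial>lborel)" by (rule nn_integral_lborel_reflect) measurable
      also have "\<dots> = (\<integral>\<^sup>+y. \<rho> (e j - z - y) * inversion (bb j) T y * w \<partial>lborel)"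
        unfolding g_def inversion_def by (intro nn_integral_cong) (simp add: ac_simps)
      also have "\<dots> = conv (e j) (inversion (bb j) T) z * w"
        unfolding conv_def by (rule nn_integral_multc) measurable
      also have "\<dots> = f (Suc j) \<omega>"
        unfolding f_def w_def T_def z_def k_def by simp
      finally show ?thesis .
    qed
    then show ?thesis
      using nn_integral_PiM_resample[where M = "site c" and f = "f j" and i = m, OF prob_space_site f_meas] by simp
  qed
  have "(\<integral>\<^sup>+\<omega>. f 0 \<omega> \<partial>PiM UNIV (site c)) = (\<integral>\<^sup>+\<omega>. f j \<omega> \<partial>PiM UNIV (site c))" if "j \<le> n" for j
    using that by (induction j) (simp_all add: step)
  then have "(\<integral>\<^sup>+\<omega>. f 0 \<omega> \<partial>PiM UNIV (site c)) = (\<integral>\<^sup>+\<omega>. f n \<omega> \<partial>PiM UNIV (site c))" by simp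
  also have "\<dots> \<le> (\<integral>\<^sup>+\<omega>. ennreal (C n) \<partial>PiM UNIV (site c))"
  proof (intro nn_integral_mono)
    fix \<omega>
    \<comment> \<open>After \<open>n\<close> steps the product is empty, and only the pointwise
      bounded transfer function remains.\<close>
    have "f n \<omega> = transfer e bb (s \<omega>) n (R \<omega> (h - n))" unfolding f_def by (simp add: h)
    also have "\<dots> \<le> ennreal (C n)" by (rule decay) (simp_all add: bb_def a)
    finally show "f n \<omega> \<le> ennreal (C n)" .
  qed
  also have "\<dots> = ennreal (C n)" by (simp add: P.emeasure_space_1)
  finally have "(\<integral>\<^sup>+\<omega>. f 0 \<omega> \<partial>PiM UNIV (site c)) \<le> ennreal (C n)" .
  moreover have "f 0 \<omega> = \<rho> (x - ric (fwd a lo) (fwd \<omega> lo) x (nat (p - lo)) - ric (bwd a (hi - 1)) (bwd \<omega> hi) x (nat (hi - p)) - c p)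
      * ennreal (\<Prod>k\<in>{nat (hi - q)..<nat (hi - p)}. \<bar>ric (bwd a (hi - 1)) (bwd \<omega> hi) x (Suc k)\<bar> / bwd a (hi - 1) k)" for \<omega>
  proof -
    have eq: "s \<omega> - R \<omega> h = x - ric (fwd a lo) (fwd \<omega> lo) x (nat (p - lo)) - R \<omega> h - c p" by (simp add: s_def)
    show ?thesis unfolding f_def transfer.simps minus_nat.diff_0 eq unfolding R_def b_def K_def h_def ..
  qed
  ultimately show ?thesis unfolding n_def by (simp only:)
qed

end

section \<open>Infinite-volume limit\<close>

lemma jac_pow_abs_le:
  assumes a: "\<And>n. \<bar>a n\<bar> \<le> A" and \<omega>: "\<And>n. \<bar>\<omega> n\<bar> \<le> M"
  shows "\<bar>jac_pow a \<omega> k m n\<bar> \<le> (M + 2 * A) ^ k"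
proof (induction k arbitrary: m)
  case (Suc k)
  have nonneg: "0 \<le> A" "0 \<le> M" using a[of 0] \<omega>[of 0] by auto
  have "\<bar>jac_pow a \<omega> (Suc k) m n\<bar> \<le> \<bar>a m * jac_pow a \<omega> k (m + 1) n\<bar>
      + \<bar>a (m - 1) * jac_pow a \<omega> k (m - 1) n\<bar> + \<bar>\<omega> m * jac_pow a \<omega> k m n\<bar>"
    unfolding jac_pow_Suc by linarith
  also have "\<dots> \<le> A * (M + 2 * A) ^ k + A * (M + 2 * A) ^ k + M * (M + 2 * A) ^ k"
    unfolding abs_mult using nonneg by (intro add_mono mult_mono a \<omega> Suc.IH) auto
  also have "\<dots> = (M + 2 * A) ^ Suc k" by (simp add: algebra_simps)
  finally show ?case .
qed simp

text \<open>Finite propagation: \<open>k\<close> hops from \<open>m\<close> use no bond cut by the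
  box.\<close>

lemma jac_pow_hop_box:
  assumes "\<bar>m\<bar> + int k \<le> L"
  shows "jac_pow (hop_box (- L) L a) \<omega> k m n = jac_pow a \<omega> k m n"
  using assms
proof (induction k arbitrary: m)
  case (Suc k)
  have "hop_box (- L) L a m = a m" "hop_box (- L) L a (m - 1) = a (m - 1)"
    using Suc.prems by (auto simp: hop_box_def)
  moreover have "\<bar>m + 1\<bar> + int k \<le> L" "\<bar>m - 1\<bar> + int k \<le> L" "\<bar>m\<bar> + int k \<le> L" using Suc.prems by auto
  ultimately show ?case unfolding jac_pow_Suc by (simp only: Suc.IH)
qed simp

lemma evol_term_norm_le:
  assumes a: "\<And>n. \<bar>a n\<bar> \<le> A" and \<omega>: "\<And>n. \<bar>\<omega> n\<bar> \<le> M"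
  shows "cmod (z ^ k / of_nat (fact k) * complex_of_real (jac_pow a \<omega> k m n)) \<le> (cmod z * (M + 2 * A)) ^ k / fact k"
proof -
  have "cmod (z ^ k / of_nat (fact k) * complex_of_real (jac_pow a \<omega> k m n)) = cmod z ^ k / fact k * \<bar>jac_pow a \<omega> k m n\<bar>"
    by (simp add: norm_mult norm_divide norm_power)
  also have "\<dots> \<le> cmod z ^ k / fact k * (M + 2 * A) ^ k"
    using jac_pow_abs_le[where a = a and \<omega> = \<omega>, OF a \<omega>] by (intro mult_left_mono) auto
  also have "\<dots> = (cmod z * (M + 2 * A)) ^ k / fact k" by (simp add: power_mult_distrib)
  finally show ?thesis .
qed

lemma summable_power_div_fact: "summable (\<lambda>k. (x::real) ^ k / fact k)"
  using summable_exp[of x] by (simp add: field_simps)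

text \<open>Each term of the exponential series is eventually independent of the box, and all terms
  are dominated by one exponential series; Tannery's theorem interchanges limit and sum.\<close>

lemma evol_entry_hop_box_tendsto:
  assumes a: "\<And>n. \<bar>a n\<bar> \<le> A" and \<omega>: "\<And>n. \<bar>\<omega> n\<bar> \<le> M"
  shows "(\<lambda>L. evol_entry (hop_box (- (int L + K)) (int L + K) a) \<omega> t m n) \<longlonglongrightarrow> evol_entry a \<omega> t m n"
proof -
  let ?z = "- \<i> * complex_of_real t"
  let ?f = "\<lambda>k L. ?z ^ k / of_nat (fact k) * complex_of_real (jac_pow (hop_box (- (int L + K)) (int L + K) a) \<omega> k m n)"
  have "0 \<le> A" using a[of 0] by simp
  then have a': "\<bar>hop_box lo hi a n\<bar> \<le> A" for lo hi n using a[of n] by (simp add: hop_box_def)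
  have "((\<lambda>L. suminf (\<lambda>k. ?f k L)) \<longlonglongrightarrow> (\<Sum>k. ?z ^ k / of_nat (fact k) * complex_of_real (jac_pow a \<omega> k m n)))"
  proof (rule tannerys_theorem[THEN conjunct2, THEN conjunct2])
    fix k
    have "eventually (\<lambda>L. jac_pow (hop_box (- (int L + K)) (int L + K) a) \<omega> k m n = jac_pow a \<omega> k m n) sequentially"
      using eventually_ge_at_top[of "nat (\<bar>m\<bar> + int k - K)"]
    proof eventually_elim
      case (elim L)
      then have "\<bar>m\<bar> + int k \<le> int L + K" by linarith
      then show ?case by (rule jac_pow_hop_box)
    qed
    then have "eventually (\<lambda>L. ?f k L = ?z ^ k / of_nat (fact k) * complex_of_real (jac_pow a \<omega> k m n)) sequentially"
      by eventually_elim (simp only:)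
    then show "(\<lambda>L. ?f k L) \<longlonglongrightarrow> ?z ^ k / of_nat (fact k) * complex_of_real (jac_pow a \<omega> k m n)"
      by (rule tendsto_eventually)
  next
    show "eventually (\<lambda>(k, L). cmod (?f k L) \<le> (cmod ?z * (M + 2 * A)) ^ k / fact k) (at_top \<times>\<^sub>F sequentially)"
    proof (rule always_eventually, clarify)
      fix k L
      show "cmod (?f k L) \<le> (cmod ?z * (M + 2 * A)) ^ k / fact k"
        by (rule evol_term_norm_le[OF a' \<omega>])
    qed
  qed (auto simp: summable_power_div_fact)
  then show ?thesis by (simp only: evol_entry_def)
qed

lemma continuous_on_evol_entry:
  assumes a: "\<And>n. \<bar>a n\<bar> \<le> A" and \<omega>: "\<And>n. \<bar>\<omega> n\<bar> \<le> M"
  shows "continuous_on UNIV (\<lambda>t. evol_entry a \<omega> t m n)"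
proof -
  let ?c = "\<lambda>k. complex_of_real (jac_pow a \<omega> k m n) / of_nat (fact k)"
  have "summable (\<lambda>k. ?c k * y ^ k)" for y
  proof (rule summable_comparison_test')
    show "summable (\<lambda>k. (cmod y * (M + 2 * A)) ^ k / fact k)" by (rule summable_power_div_fact)
    show "norm (?c k * y ^ k) \<le> (cmod y * (M + 2 * A)) ^ k / fact k" for k
      using evol_term_norm_le[where a = a and \<omega> = \<omega> and z = y and k = k and m = m and n = n, OF a \<omega>]
      by (simp add: ac_simps)
  qed
  then have "isCont (\<lambda>y. \<Sum>k. ?c k * y ^ k) y" for y
    by (rule isCont_powser_converges_everywhere)
  then have "continuous_on UNIV (\<lambda>y. \<Sum>k. ?c k * y ^ k)"
    by (simp add: continuous_on_eq_continuous_at)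
  then have "continuous_on UNIV (\<lambda>t. \<Sum>k. ?c k * (- \<i> * complex_of_real t) ^ k)"
    by (rule continuous_on_compose2) (auto intro!: continuous_intros)
  moreover have "(\<lambda>t. \<Sum>k. ?c k * (- \<i> * complex_of_real t) ^ k) = (\<lambda>t. evol_entry a \<omega> t m n)"
    unfolding evol_entry_def by (intro ext suminf_cong) (simp add: ac_simps)
  ultimately show ?thesis by (simp only:)
qed

text \<open>Continuity in time reduces real times to rational ones. The countable supremum on the
  right is measurable in the potential, as Fatou's lemma demands.\<close>

lemma evol_entry_le_liminf:
  assumes a: "\<And>n. \<bar>a n\<bar> \<le> A" and \<omega>: "\<And>n. \<bar>\<omega> n\<bar> \<le> M"
  shows "(SUP t\<in>UNIV. ennreal (cmod (evol_entry a \<omega> t m n)))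
    \<le> liminf (\<lambda>L. SUP t\<in>\<rat>. ennreal (cmod (evol_entry (hop_box (- (int L + K)) (int L + K) a) \<omega> t m n)))"
    (is "_ \<le> liminf ?G")
proof (rule SUP_least)
  fix t :: real
  have rat: "ennreal (cmod (evol_entry a \<omega> t m n)) \<le> liminf ?G" if "t \<in> \<rat>" for t
  proof -
    have "(\<lambda>L. ennreal (cmod (evol_entry (hop_box (- (int L + K)) (int L + K) a) \<omega> t m n)))
        \<longlonglongrightarrow> ennreal (cmod (evol_entry a \<omega> t m n))"
      by (intro tendsto_ennrealI tendsto_norm evol_entry_hop_box_tendsto[where a = a and \<omega> = \<omega>, OF a \<omega>])
    then have "ennreal (cmod (evol_entry a \<omega> t m n))
        = liminf (\<lambda>L. ennreal (cmod (evol_entry (hop_box (- (int L + K)) (int L + K) a) \<omega> t m n)))"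
      by (intro lim_imp_Liminf[symmetric]) auto
    also have "\<dots> \<le> liminf ?G"
      by (intro Liminf_mono always_eventually allI SUP_upper that)
    finally show ?thesis .
  qed
  have "t \<in> closure \<rat>" by (simp add: Rats_closure_real)
  then obtain X where X: "\<And>i. X i \<in> \<rat>" "X \<longlonglongrightarrow> t" unfolding closure_sequential by blast
  have "(\<lambda>i. ennreal (cmod (evol_entry a \<omega> (X i) m n))) \<longlonglongrightarrow> ennreal (cmod (evol_entry a \<omega> t m n))"
    by (intro tendsto_ennrealI tendsto_norm
        continuous_on_tendsto_compose[OF continuous_on_evol_entry[where a = a and \<omega> = \<omega>, OF a \<omega>] X(2)]) auto
  then show "ennreal (cmod (evol_entry a \<omega> t m n)) \<le> liminf ?G"
    by (rule LIMSEQ_le_const2) (use rat X(1) in blast)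
qed

section \<open>Averaged decay in a box\<close>

context bounded_density
begin

lemma evol_entry_measurable [measurable]:
  "(\<lambda>\<omega>. evol_entry a \<omega> t m n) \<in> borel_measurable (PiM UNIV (site c))"
proof -
  have coord [measurable]: "(\<lambda>\<omega>. \<omega> k) \<in> borel_measurable (PiM UNIV (site c))" for k
    using measurable_component_singleton[of k UNIV "site c"] by simp
  have "(\<lambda>\<omega>. jac_pow a \<omega> k m n) \<in> borel_measurable (PiM UNIV (site c))" for k
  proof (induction k arbitrary: m)
    case (Suc k)
    note [measurable] = Suc
    show ?case unfolding jac_pow_Suc by measurable
  qed simp
  note [measurable] = this
  show ?thesis unfolding evol_entry_def by measurable
qed

lemma nn_integral_box_evol_le:
  fixes a c :: "int \<Rightarrow> real"
  assumes a: "\<And>n. 0 < a n" "\<And>n. a n \<le> A" and order: "lo \<le> p" "p \<le> q" "q \<le> hi"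
    and ij: "i = p \<and> j = q \<or> i = q \<and> j = p"
    and decay: "\<And>e b s j z. \<forall>i. 0 < b i \<and> b i \<le> A \<Longrightarrow> transfer e b s j z \<le> ennreal (C j)"
    and supp: "\<And>n V. \<rho> (V - c n) \<noteq> 0 \<Longrightarrow> \<bar>V\<bar> \<le> M" and "M \<ge> 0"
    and AE_M: "AE \<omega> in PiM UNIV (site c). \<forall>n. \<bar>\<omega> n\<bar> \<le> M"
  shows "(\<integral>\<^sup>+\<omega>. (SUP t\<in>\<rat>. ennreal (cmod (evol_entry (hop_box lo hi a) \<omega> t i j))) \<partial>PiM UNIV (site c))
    \<le> ennreal (2 * (M + 2 * A)) * ennreal (C (nat (q - p)))"
proof -
  interpret P: prob_space "PiM UNIV (site c)" by (rule prob_space_PiM) (rule prob_space_site)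
  interpret PP: pair_sigma_finite lborel "PiM UNIV (site c)" ..
  let ?\<mu> = "PiM UNIV (site c)" and ?I = "{- (M + 2 * A)..M + 2 * A}"
  let ?G = "\<lambda>\<omega>. SUP t\<in>\<rat>. ennreal (cmod (evol_entry (hop_box lo hi a) \<omega> t i j))"
  define H where "H x \<omega> = \<rho> (x - ric (fwd a lo) (fwd \<omega> lo) x (nat (p - lo)) - ric (bwd a (hi - 1)) (bwd \<omega> hi) x (nat (hi - p)) - c p)
      * ennreal (\<Prod>k\<in>{nat (hi - q)..<nat (hi - p)}. \<bar>ric (bwd a (hi - 1)) (bwd \<omega> hi) x (Suc k)\<bar> / bwd a (hi - 1) k)" for x \<omega>
  have A: "\<bar>a n\<bar> \<le> A" for n using a[of n] by simp
  have "A > 0" using a[of 0] by linarith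
  have G_meas [measurable]: "?G \<in> borel_measurable ?\<mu>"
    by (intro borel_measurable_SUP countable_rat) measurable
  have H_meas [measurable]: "(\<lambda>w. H (fst w) (snd w)) \<in> borel_measurable (lborel \<Otimes>\<^sub>M ?\<mu>)"
  proof -
    have [measurable]: "(\<lambda>w. ric (fwd a lo) (fwd (snd w) lo) (fst w) k) \<in> borel_measurable (lborel \<Otimes>\<^sub>M ?\<mu>)" for k
      by (intro ric_measurable measurable_compose[OF measurable_snd fwd_bwd_measurable(1)]) measurable
    have [measurable]: "(\<lambda>w. ric (bwd a (hi - 1)) (bwd (snd w) hi) (fst w) k) \<in> borel_measurable (lborel \<Otimes>\<^sub>M ?\<mu>)" for k
      by (intro ric_measurable measurable_compose[OF measurable_snd fwd_bwd_measurable(2)]) measurable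
    show ?thesis unfolding H_def by measurable
  qed
  \<comment> \<open>Resampling at \<open>p\<close> exposes the integral over a single potential, to
    which spectral averaging applies. Exchanging integrals then fixes the energy, and the length of
    the window becomes the prefactor.\<close>
  have "(\<integral>\<^sup>+\<omega>. ?G \<omega> \<partial>?\<mu>) = (\<integral>\<^sup>+\<omega>. \<integral>\<^sup>+V. ?G (fun_upd \<omega> p V) \<partial>site c p \<partial>?\<mu>)"
    by (rule nn_integral_PiM_resample[where M = "site c", OF prob_space_site G_meas])
  also have "\<dots> \<le> (\<integral>\<^sup>+\<omega>. \<integral>\<^sup>+x. indicator ?I x * H x \<omega> \<partial>lborel \<partial>?\<mu>)"
  proof (rule nn_integral_mono_AE)
    show "AE \<omega> in ?\<mu>. (\<integral>\<^sup>+V. ?G (fun_upd \<omega> p V) \<partial>site c p) \<le> (\<integral>\<^sup>+x. indicator ?I x * H x \<omega> \<partial>lborel)"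
      using AE_M
    proof eventually_elim
      case (elim \<omega>)
      have "(\<lambda>V. fun_upd \<omega> p V) \<in> borel \<rightarrow>\<^sub>M ?\<mu>"
        by (rule measurable_PiM_single') (auto simp: fun_upd_def space_PiM site_def)
      then have [measurable]: "(\<lambda>V. ?G (fun_upd \<omega> p V)) \<in> borel_measurable borel"
        by (rule measurable_compose[OF _ G_meas])
      have "(\<integral>\<^sup>+V. ?G (fun_upd \<omega> p V) \<partial>site c p) = (\<integral>\<^sup>+V. \<rho> (V - c p) * ?G (fun_upd \<omega> p V) \<partial>lborel)"
        by (rule nn_integral_site) measurable
      also have "\<dots> \<le> (\<integral>\<^sup>+x. indicator ?I x * H x \<omega> \<partial>lborel)"
        unfolding H_def
        by (rule spectral_averaging[where \<rho> = "\<lambda>V. \<rho> (V - c p)" and a = a, OF a(1) A order ij])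
          (use elim supp in auto)
      finally show ?case .
    qed
  qed
  also have "\<dots> = (\<integral>\<^sup>+x. \<integral>\<^sup>+\<omega>. indicator ?I x * H x \<omega> \<partial>?\<mu> \<partial>lborel)"
    by (rule PP.Fubini') (simp add: split_beta', measurable)
  also have "\<dots> = (\<integral>\<^sup>+x. indicator ?I x * (\<integral>\<^sup>+\<omega>. H x \<omega> \<partial>?\<mu>) \<partial>lborel)"
  proof (intro nn_integral_cong nn_integral_cmult)
    fix x
    show "H x \<in> borel_measurable ?\<mu>"
      using measurable_compose[OF measurable_Pair1' H_meas, of x] by simp
  qed
  also have "\<dots> \<le> (\<integral>\<^sup>+x. indicator ?I x * ennreal (C (nat (q - p))) \<partial>lborel)"
    unfolding H_def
    by (intro nn_integral_mono mult_left_mono nn_integral_weighted_product_le[OF a order(2,3) decay]) auto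
  also have "\<dots> = ennreal (2 * (M + 2 * A)) * ennreal (C (nat (q - p)))"
    using \<open>M \<ge> 0\<close> \<open>A > 0\<close> by (subst nn_integral_multc) (simp_all add: algebra_simps)
  finally show ?thesis .
qed

end

lemma (in bounded_density) AE_site_bounded:
  assumes supp: "\<And>n V. \<rho> (V - c n) \<noteq> 0 \<Longrightarrow> \<bar>V\<bar> \<le> M"
  shows "AE \<omega> in PiM UNIV (site c). \<forall>n. \<bar>\<omega> n\<bar> \<le> M"
proof (subst AE_all_countable, rule allI)
  fix n
  have "AE V in site c n. \<bar>V\<bar> \<le> M"
    unfolding site_def by (subst AE_density) (auto intro!: AE_I2 supp[of _ n])
  then show "AE \<omega> in PiM UNIV (site c). \<bar>\<omega> n\<bar> \<le> M"
    by (intro AE_PiM_component[where P = "\<lambda>V. \<bar>V\<bar> \<le> M"] prob_space_site) auto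
qed

lemma power_half_le_exp:
  fixes \<kappa> :: real
  assumes "0 < \<kappa>" "\<kappa> < 1"
  shows "\<kappa> ^ ((n - 1) div 2) \<le> 1 / \<kappa> * exp (- (- ln \<kappa> / 2) * real n)"
proof -
  have "\<kappa> ^ ((n - 1) div 2) = exp (real ((n - 1) div 2) * ln \<kappa>)"
    using assms by (simp add: exp_of_nat_mult)
  also have "\<dots> \<le> exp ((real n / 2 - 1) * ln \<kappa>)"
  proof -
    \<comment> \<open>Truncated subtraction and integer division together lose at most 1, which
      costs the factor \<open>1 / \<kappa>\<close>; the bound includes \<open>n = 0\<close>.\<close>
    have "real n / 2 - 1 \<le> real ((n - 1) div 2)" by linarith
    moreover have "ln \<kappa> \<le> 0" using assms by simp
    ultimately show ?thesis by (simp add: mult_right_mono_neg)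
  qed
  also have "\<dots> = exp (- ln \<kappa>) * exp (- (- ln \<kappa> / 2) * real n)"
    by (simp add: algebra_simps flip: exp_add)
  also have "exp (- ln \<kappa>) = 1 / \<kappa>" using assms by (simp add: exp_minus inverse_eq_divide)
  finally show ?thesis .
qed

theorem theorem2p3:
  fixes r :: "real \<Rightarrow> real" and d c a :: "int \<Rightarrow> real" and \<delta> :: real
  assumes r_nonneg: "\<And>x. r x \<ge> 0"
    and r_bounded: "\<exists>B. \<forall>x. r x \<le> B"
    and r_meas: "r \<in> borel_measurable borel"
    and r_supp: "\<exists>R. \<forall>x. \<bar>x\<bar> > R \<longrightarrow> r x = 0"
    and r_int: "(\<integral>\<^sup>+ x. ennreal (r x) \<partial>lborel) = 1"
    and d_one: "\<And>n. d n = 1"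
    and c_bounded: "\<exists>B. \<forall>n. \<bar>c n\<bar> \<le> B"
    and a_bounded: "\<exists>B. \<forall>n. \<bar>a n\<bar> \<le> B"
    and \<delta>_pos: "\<delta> > 0"
    and a_lower: "\<And>n. a n \<ge> \<delta>"
  shows "\<exists>C \<gamma>. C > 0 \<and> \<gamma> > 0 \<and>
    (\<forall>m::int. (\<integral>\<^sup>+ \<omega>. (SUP t\<in>UNIV. ennreal (cmod (evol_entry a \<omega> t m 0))) \<partial>anderson_measure r d c)
        \<le> ennreal (C * exp (- \<gamma> * real_of_int \<bar>m\<bar>)))"
proof -
  obtain B0 where B0: "\<And>x. r x \<le> B0" using r_bounded by blast
  obtain R where R: "\<And>x. \<bar>x\<bar> > R \<Longrightarrow> r x = 0" using r_supp by blast
  obtain c0 where c0: "\<And>n. \<bar>c n\<bar> \<le> c0" using c_bounded by blast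
  obtain A where A: "\<And>n. \<bar>a n\<bar> \<le> A" using a_bounded by blast
  define B where "B = max B0 1"
  define M where "M = \<bar>R\<bar> + c0"
  interpret bounded_density "\<lambda>x. ennreal (r x)" B
  proof
    show "ennreal (r x) \<le> ennreal B" for x using B0[of x] by (intro ennreal_leI) (simp add: B_def)
    show "0 < B" by (simp add: B_def)
    show "(\<lambda>x. ennreal (r x)) \<in> borel_measurable borel" using r_meas by measurable
  qed (rule r_int)
  have \<mu>: "anderson_measure r d c = PiM UNIV (site c)"
  proof -
    have "site_measure r d c = site c" by (rule ext) (simp add: site_measure_def site_def d_one)
    then show ?thesis by (simp add: anderson_measure_def)
  qed
  have a: "0 < a n" "a n \<le> A" for n using a_lower[of n] \<delta>_pos A[of n] by auto
  have "A > 0" using a[of 0] by linarith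
  have "M \<ge> 0" using c0[of 0] by (simp add: M_def)
  have supp: "\<bar>V\<bar> \<le> M" if "ennreal (r (V - c n)) \<noteq> 0" for n V
  proof -
    have "\<not> \<bar>V - c n\<bar> > R" using R[of "V - c n"] that by auto
    then show ?thesis using c0[of n] by (simp add: M_def)
  qed
  obtain \<kappa> where \<kappa>: "0 < \<kappa>" "\<kappa> < 1"
    "\<And>e b s j z. \<forall>i. 0 < b i \<and> b i \<le> A \<Longrightarrow> transfer e b s j z \<le> ennreal (B * \<kappa> ^ ((j - 1) div 2))"
    by (rule transfer_decay[OF \<open>A > 0\<close>]) (rule that)
  have AE_M: "AE \<omega> in PiM UNIV (site c). \<forall>n. \<bar>\<omega> n\<bar> \<le> M"
    by (rule AE_site_bounded) (rule supp)
  \<comment> \<open>Window length \<open>2 * (M + 2 * A)\<close>, times the sup bound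
    \<open>B\<close> of the density, times the rounding loss \<open>1 / \<kappa>\<close>. In
    \<open>\<gamma>\<close> the half reflects one factor \<open>\<kappa>\<close> per two
    sites.\<close>
  define C where "C = 2 * (M + 2 * A) * B / \<kappa>"
  define \<gamma> where "\<gamma> = - ln \<kappa> / 2"
  have bound: "(\<integral>\<^sup>+ \<omega>. (SUP t\<in>UNIV. ennreal (cmod (evol_entry a \<omega> t m 0))) \<partial>anderson_measure r d c)
      \<le> ennreal (C * exp (- \<gamma> * real_of_int \<bar>m\<bar>))" for m
  proof -
    \<comment> \<open>The half-width \<open>int L + \<bar>m\<bar>\<close> puts both \<open>0\<close>
      and \<open>m\<close> in the box for every \<open>L\<close>.\<close>
    let ?G = "\<lambda>L \<omega>. SUP t\<in>\<rat>. ennreal (cmod (evol_entry (hop_box (- (int L + \<bar>m\<bar>)) (int L + \<bar>m\<bar>) a) \<omega> t m 0))"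
    have "(\<integral>\<^sup>+ \<omega>. (SUP t\<in>UNIV. ennreal (cmod (evol_entry a \<omega> t m 0))) \<partial>PiM UNIV (site c))
        \<le> (\<integral>\<^sup>+ \<omega>. liminf (\<lambda>L. ?G L \<omega>) \<partial>PiM UNIV (site c))"
    proof (rule nn_integral_mono_AE)
      show "AE \<omega> in PiM UNIV (site c). (SUP t\<in>UNIV. ennreal (cmod (evol_entry a \<omega> t m 0))) \<le> liminf (\<lambda>L. ?G L \<omega>)"
        using AE_M
      proof eventually_elim
        case (elim \<omega>)
        then have "\<bar>\<omega> n\<bar> \<le> M" for n by blast
        then show ?case by (rule evol_entry_le_liminf[where a = a and \<omega> = \<omega>, OF A])
      qed
    qed
    also have "\<dots> \<le> liminf (\<lambda>L. \<integral>\<^sup>+ \<omega>. ?G L \<omega> \<partial>PiM UNIV (site c))"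
      by (intro nn_integral_liminf borel_measurable_SUP countable_rat) measurable
    also have "\<dots> \<le> liminf (\<lambda>L. ennreal (2 * (M + 2 * A)) * ennreal (B * \<kappa> ^ ((nat \<bar>m\<bar> - 1) div 2)))"
    proof (intro Liminf_mono always_eventually allI)
      fix L
      \<comment> \<open>The box estimate is used with \<open>p = min m 0\<close> and
        \<open>q = max m 0\<close>, which covers both signs of \<open>m\<close>.\<close>
      have "nat (max m 0 - min m 0) = nat \<bar>m\<bar>" by auto
      moreover have "(\<integral>\<^sup>+ \<omega>. ?G L \<omega> \<partial>PiM UNIV (site c))
          \<le> ennreal (2 * (M + 2 * A)) * ennreal (B * \<kappa> ^ ((nat (max m 0 - min m 0) - 1) div 2))"
        by (rule nn_integral_box_evol_le[where a = a and C = "\<lambda>j. B * \<kappa> ^ ((j - 1) div 2)", OF a _ _ _ _ \<kappa>(3) supp \<open>M \<ge> 0\<close> AE_M])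
          auto
      ultimately show "(\<integral>\<^sup>+ \<omega>. ?G L \<omega> \<partial>PiM UNIV (site c))
          \<le> ennreal (2 * (M + 2 * A)) * ennreal (B * \<kappa> ^ ((nat \<bar>m\<bar> - 1) div 2))" by simp
    qed
    also have "\<dots> = ennreal (2 * (M + 2 * A) * (B * \<kappa> ^ ((nat \<bar>m\<bar> - 1) div 2)))"
      using \<open>M \<ge> 0\<close> \<open>A > 0\<close> by (simp add: Liminf_const ennreal_mult')
    also have "\<dots> \<le> ennreal (2 * (M + 2 * A) * (B * (1 / \<kappa> * exp (- \<gamma> * real_of_int \<bar>m\<bar>))))"
      using \<open>M \<ge> 0\<close> \<open>A > 0\<close> B_pos power_half_le_exp[OF \<kappa>(1,2), of "nat \<bar>m\<bar>"]
      by (intro ennreal_leI mult_left_mono) (simp_all add: \<gamma>_def)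
    also have "2 * (M + 2 * A) * (B * (1 / \<kappa> * exp (- \<gamma> * real_of_int \<bar>m\<bar>))) = C * exp (- \<gamma> * real_of_int \<bar>m\<bar>)"
      by (simp add: C_def)
    finally show ?thesis unfolding \<mu> .
  qed
  have "C > 0" using \<open>M \<ge> 0\<close> \<open>A > 0\<close> B_pos \<kappa>(1) unfolding C_def by (intro divide_pos_pos mult_pos_pos) auto
  moreover have "\<gamma> > 0" using \<kappa>(1,2) by (simp add: \<gamma>_def)
  ultimately show ?thesis using bound by blast
qed

end
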